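(* For $k\in\mathbb Z$ let $\phi_k$ be the 2-cocycle on $\mathscr W(\Gamma,s)$ defined by $$\phi_k(L_{\alpha,i},L_{\beta,j})=\delta_{\alpha+\beta,0}\,\delta_{i+j,k}\,\frac{\alpha^3-\alpha}{12},\qquad\alpha,\beta\in\Gamma,\ i,j\in\mathbb Z,$$ with all other components (on pairs of basis elements) vanishing, and let $\bar\phi_k$ be its cohomology class. Then the second cohomology group $$H^2(\mathscr W(\Gamma,s),\mathbb F)=\prod_{k\in\mathbb Z}\mathbb F\bar\phi_k$$ is the direct product of all $\mathbb F\bar\phi_k$, $k\in\mathbb Z$.
   Context: Let $\mathbb F$ be a field of characteristic $0$, $\Gamma$ a proper additive subgroup of $\mathbb F$, and $s\in\mathbb F$ with $s\notin\Gamma$, $2s\in\Gamma$. The generalized loop Schr\"odinger-Virasoro algebra $\mathscr W(\Gamma,s)$ is the Lie algebra over $\mathbb F$ with basis $\{L_{\alpha,i},M_{\alpha,i},Y_{\alpha+s,i}\mid\alpha\in\Gamma,\ i\in\mathbb Z\}$ and brackets $[L_{\alpha,i},L_{\beta,j}]=(\beta-\alpha)L_{\alpha+\beta,i+j}$, $[L_{\alpha,i},M_{\beta,j}]=\beta M_{\alpha+\beta,i+j}$, $[L_{\alpha,i},Y_{\beta+s,j}]=(\beta+s-\frac{\alpha}{2})Y_{\alpha+\beta+s,i+j}$, $[M_{\alpha,i},M_{\beta,j}]=0$, $[M_{\alpha,i},Y_{\beta+s,j}]=0$, $[Y_{\alpha+s,i},Y_{\beta+s,j}]=(\beta-\alpha)M_{\alpha+\beta+2s,i+j}$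 for $\alpha,\beta\in\Gamma$, $i,j\in\mathbb Z$. A 2-cocycle on $\mathscr W(\Gamma,s)$ is a bilinear form $\psi:\mathscr W(\Gamma,s)\times\mathscr W(\Gamma,s)\to\mathbb F$ with $\psi(x,y)=-\psi(y,x)$ and $\psi(x,[y,z])+\psi(y,[z,x])+\psi(z,[x,y])=0$. For a linear function $f:\mathscr W(\Gamma,s)\to\mathbb F$, the 2-cocycle $\psi_f(x,y)=f([x,y])$ is called a 2-coboundary. $H^2(\mathscr W(\Gamma,s),\mathbb F)$ is the quotient of the space of 2-cocycles by the space of 2-coboundaries. An element $(c_k\bar\phi_k)_{k}$ of the direct product corresponds to the class of the (pointwise finite on basis pairs) sum $\sum_k c_k\phi_k$. *)

theory Defs
  imports Complex_Main "HOL-Library.Poly_Mapping" "HOL-Library.FuncSet"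
begin

text \<open>
  Vectors are finitely supported coefficient families over a set of basis labels.  The label
  \<open>Yb a i\<close> carries its full index, so the basis element $Y_{\alpha+s,i}$ is
  \<open>Yb (\<alpha> + s) i\<close> with \<open>\<alpha> \<in> \<Gamma>\<close>.
\<close>

datatype 'f sv_index = Lb 'f int | Mb 'f int | Yb 'f int

definition vscale :: "'f \<Rightarrow> ('b \<Rightarrow>\<^sub>0 'f) \<Rightarrow> ('b \<Rightarrow>\<^sub>0 'f::field)" where
  "vscale c x = Poly_Mapping.map (\<lambda>t. c * t) x"

definition sv_basis :: "'f set \<Rightarrow> 'f \<Rightarrow> 'f::field sv_index set" where
  "sv_basis \<Gamma> s = {Lb \<alpha> i | \<alpha> i. \<alpha> \<in> \<Gamma>} \<union> {Mb \<alpha> i | \<alpha> i. \<alpha> \<in> \<Gamma>} \<union> {Yb (\<alpha> + s) i | \<alpha> i. \<alpha> \<in> \<Gamma>}"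

definition sv_carrier :: "'f set \<Rightarrow> 'f \<Rightarrow> ('f sv_index \<Rightarrow>\<^sub>0 'f::field) set" where
  "sv_carrier \<Gamma> s = {x. Poly_Mapping.keys x \<subseteq> sv_basis \<Gamma> s}"

text \<open>
  In the clauses for \<open>Yb\<close> the index \<open>b\<close> stands for $\beta+s$ (and \<open>a\<close> for $\alpha+s$), so that
  \<open>b - a\<close> is $\beta-\alpha$ and \<open>a + b\<close> is $\alpha+\beta+2s$ in the bracket of two \<open>Y\<close>s.
  The clauses \<open>ML\<close> and \<open>YL\<close> are those for \<open>LM\<close> and \<open>LY\<close>, read by antisymmetry.
\<close>

fun sv_bracket_basis :: "'f sv_index \<Rightarrow> 'f sv_index \<Rightarrow> ('f sv_index \<Rightarrow>\<^sub>0 'f::field)" where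
  "sv_bracket_basis (Lb a i) (Lb b j) = Poly_Mapping.single (Lb (a + b) (i + j)) (b - a)"
| "sv_bracket_basis (Lb a i) (Mb b j) = Poly_Mapping.single (Mb (a + b) (i + j)) b"
| "sv_bracket_basis (Mb a i) (Lb b j) = Poly_Mapping.single (Mb (a + b) (i + j)) (- a)"
| "sv_bracket_basis (Lb a i) (Yb b j) = Poly_Mapping.single (Yb (a + b) (i + j)) (b - a / 2)"
| "sv_bracket_basis (Yb a i) (Lb b j) = Poly_Mapping.single (Yb (a + b) (i + j)) (- (a - b / 2))"
| "sv_bracket_basis (Mb a i) (Mb b j) = 0"
| "sv_bracket_basis (Mb a i) (Yb b j) = 0"
| "sv_bracket_basis (Yb a i) (Mb b j) = 0"
| "sv_bracket_basis (Yb a i) (Yb b j) = Poly_Mapping.single (Mb (a + b) (i + j)) (b - a)"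

definition sv_bracket ::
    "('f sv_index \<Rightarrow>\<^sub>0 'f) \<Rightarrow> ('f sv_index \<Rightarrow>\<^sub>0 'f) \<Rightarrow> ('f sv_index \<Rightarrow>\<^sub>0 'f::field)" where
  "sv_bracket x y =
     (\<Sum>p\<in>Poly_Mapping.keys x. \<Sum>q\<in>Poly_Mapping.keys y.
        vscale (Poly_Mapping.lookup x p * Poly_Mapping.lookup y q) (sv_bracket_basis p q))"

text \<open>
  \<open>W\<close> is a linear subspace and \<open>br\<close> a Lie bracket on it.  A form on \<open>W\<close> is a function on the
  ambient type whose values off \<open>W \<times> W\<close> are fixed to be zero, so that equality of such functions
  is equality of forms on \<open>W\<close>.
\<close>

type_synonym ('b, 'f) form = "('b \<Rightarrow>\<^sub>0 'f) \<Rightarrow> ('b \<Rightarrow>\<^sub>0 'f) \<Rightarrow> 'f"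

definition linear_form_on :: "('b \<Rightarrow>\<^sub>0 'f::field) set \<Rightarrow> (('b \<Rightarrow>\<^sub>0 'f) \<Rightarrow> 'f) \<Rightarrow> bool" where
  "linear_form_on W f \<longleftrightarrow>
     (\<forall>x\<in>W. \<forall>y\<in>W. f (x + y) = f x + f y) \<and> (\<forall>c. \<forall>x\<in>W. f (vscale c x) = c * f x)"

definition bilinear_form_on ::
    "('b \<Rightarrow>\<^sub>0 'f::field) set \<Rightarrow> ('b, 'f) form \<Rightarrow> bool" where
  "bilinear_form_on W \<psi> \<longleftrightarrow>
     (\<forall>y\<in>W. linear_form_on W (\<lambda>x. \<psi> x y)) \<and> (\<forall>x\<in>W. linear_form_on W (\<psi> x)) \<and>
     (\<forall>x y. x \<notin> W \<or> y \<notin> W \<longrightarrow> \<psi> x y = 0)"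

definition cocycles2 ::
    "('b \<Rightarrow>\<^sub>0 'f::field) set \<Rightarrow> (('b \<Rightarrow>\<^sub>0 'f) \<Rightarrow> ('b \<Rightarrow>\<^sub>0 'f) \<Rightarrow> ('b \<Rightarrow>\<^sub>0 'f)) \<Rightarrow> ('b, 'f) form set" where
  "cocycles2 W br = {\<psi>. bilinear_form_on W \<psi> \<and>
     (\<forall>x\<in>W. \<forall>y\<in>W. \<psi> x y = - \<psi> y x) \<and>
     (\<forall>x\<in>W. \<forall>y\<in>W. \<forall>z\<in>W. \<psi> x (br y z) + \<psi> y (br z x) + \<psi> z (br x y) = 0)}"

definition coboundary2 ::
    "('b \<Rightarrow>\<^sub>0 'f::field) set \<Rightarrow> (('b \<Rightarrow>\<^sub>0 'f) \<Rightarrow> ('b \<Rightarrow>\<^sub>0 'f) \<Rightarrow> ('b \<Rightarrow>\<^sub>0 'f)) \<Rightarrow>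
     (('b \<Rightarrow>\<^sub>0 'f) \<Rightarrow> 'f) \<Rightarrow> ('b, 'f) form" where
  "coboundary2 W br f = (\<lambda>x y. if x \<in> W \<and> y \<in> W then f (br x y) else 0)"

definition coboundaries2 ::
    "('b \<Rightarrow>\<^sub>0 'f::field) set \<Rightarrow> (('b \<Rightarrow>\<^sub>0 'f) \<Rightarrow> ('b \<Rightarrow>\<^sub>0 'f) \<Rightarrow> ('b \<Rightarrow>\<^sub>0 'f)) \<Rightarrow> ('b, 'f) form set" where
  "coboundaries2 W br = {coboundary2 W br f | f. linear_form_on W f}"

definition cohomologous ::
    "('b \<Rightarrow>\<^sub>0 'f::field) set \<Rightarrow> (('b \<Rightarrow>\<^sub>0 'f) \<Rightarrow> ('b \<Rightarrow>\<^sub>0 'f) \<Rightarrow> ('b \<Rightarrow>\<^sub>0 'f)) \<Rightarrow>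
     (('b, 'f) form \<times> ('b, 'f) form) set" where
  "cohomologous W br = {(\<psi>, \<psi>'). \<psi> \<in> cocycles2 W br \<and> \<psi>' \<in> cocycles2 W br \<and>
     (\<lambda>x y. \<psi> x y - \<psi>' x y) \<in> coboundaries2 W br}"

definition coh_class ::
    "('b \<Rightarrow>\<^sub>0 'f::field) set \<Rightarrow> (('b \<Rightarrow>\<^sub>0 'f) \<Rightarrow> ('b \<Rightarrow>\<^sub>0 'f) \<Rightarrow> ('b \<Rightarrow>\<^sub>0 'f)) \<Rightarrow>
     ('b, 'f) form \<Rightarrow> ('b, 'f) form set" where
  "coh_class W br \<psi> = cohomologous W br `` {\<psi>}"

definition H2 ::
    "('b \<Rightarrow>\<^sub>0 'f::field) set \<Rightarrow> (('b \<Rightarrow>\<^sub>0 'f) \<Rightarrow> ('b \<Rightarrow>\<^sub>0 'f) \<Rightarrow> ('b \<Rightarrow>\<^sub>0 'f)) \<Rightarrow> ('b, 'f) form set set" where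
  "H2 W br = cocycles2 W br // cohomologous W br"

text \<open>
  The vector space operations of the quotient, on cosets of the space of coboundaries; the zero
  class is the space of coboundaries itself.  In \<open>H2_scale\<close> a coboundary is added in order that
  the zero multiple of a coset be the whole zero coset.
\<close>

definition H2_add ::
    "('b, 'f) form set \<Rightarrow> ('b, 'f) form set \<Rightarrow> ('b, 'f::field) form set" where
  "H2_add A B = {\<lambda>x y. \<psi> x y + \<psi>' x y | \<psi> \<psi>'. \<psi> \<in> A \<and> \<psi>' \<in> B}"

definition H2_scale ::
    "('b \<Rightarrow>\<^sub>0 'f::field) set \<Rightarrow> (('b \<Rightarrow>\<^sub>0 'f) \<Rightarrow> ('b \<Rightarrow>\<^sub>0 'f) \<Rightarrow> ('b \<Rightarrow>\<^sub>0 'f)) \<Rightarrow>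
     'f \<Rightarrow> ('b, 'f) form set \<Rightarrow> ('b, 'f) form set" where
  "H2_scale W br c A = {\<lambda>x y. c * \<psi> x y + \<beta> x y | \<psi> \<beta>. \<psi> \<in> A \<and> \<beta> \<in> coboundaries2 W br}"

definition H2_line ::
    "('b \<Rightarrow>\<^sub>0 'f::field) set \<Rightarrow> (('b \<Rightarrow>\<^sub>0 'f) \<Rightarrow> ('b \<Rightarrow>\<^sub>0 'f) \<Rightarrow> ('b \<Rightarrow>\<^sub>0 'f)) \<Rightarrow>
     ('b, 'f) form set \<Rightarrow> ('b, 'f) form set set" where
  "H2_line W br A = range (\<lambda>c. H2_scale W br c A)"

fun phi_basis :: "int \<Rightarrow> 'f sv_index \<Rightarrow> 'f sv_index \<Rightarrow> 'f::field" where
  "phi_basis k (Lb a i) (Lb b j) = (if a + b = 0 \<and> i + j = k then (a ^ 3 - a) / 12 else 0)"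
| "phi_basis k _ _ = 0"

definition phi :: "'f set \<Rightarrow> 'f \<Rightarrow> int \<Rightarrow> ('f sv_index, 'f::field) form" where
  "phi \<Gamma> s k = (\<lambda>x y. if x \<in> sv_carrier \<Gamma> s \<and> y \<in> sv_carrier \<Gamma> s then
     (\<Sum>p\<in>Poly_Mapping.keys x. \<Sum>q\<in>Poly_Mapping.keys y.
        Poly_Mapping.lookup x p * Poly_Mapping.lookup y q * phi_basis k p q) else 0)"

text \<open>
  For fixed arguments only finitely many \<open>phi \<Gamma> s k x y\<close> are nonzero, so \<open>Sum_any\<close> (the sum over
  the support) is the pointwise finite sum over all integers \<open>k\<close>.
\<close>

definition phi_sum :: "'f set \<Rightarrow> 'f \<Rightarrow> (int \<Rightarrow> 'f) \<Rightarrow> ('f sv_index, 'f::field) form" where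
  "phi_sum \<Gamma> s c = (\<lambda>x y. Sum_any (\<lambda>k. c k * phi \<Gamma> s k x y))"

end

theory Submission
  imports Defs
begin

text \<open>
  Since \<open>[L_{0,0}, x] = w x\<close> for a basis element \<open>x\<close> of weight \<open>w\<close>, the Jacobi identity with
  third entry \<open>L_{0,0}\<close> shows that a cocycle agrees on pairs of nonzero total weight with the
  coboundary of \<open>x \<mapsto> \<psi> (L_{0,0}, x) / w\<close>.  On pairs of total weight zero the Jacobi
  identities become functional equations.  Those involving a zero weight force the values to
  depend on the loop degrees only through their sum, up to a term additive in the degree which the
  remaining equations kill.  What is left is \<open>\<psi> (L_\<alpha>, L_{-\<alpha>}) = c \<alpha>\<^sup>3 + d \<alpha>\<close>, where
  the linear part is a coboundary, and \<open>\<psi> (L_\<alpha>, M_{-\<alpha>}) = d \<alpha> + d' \<alpha>\<^sup>2\<close>, where the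
  extension to the \<open>Y\<close> components forces \<open>d' = 0\<close>.  Pairs of an \<open>L\<close> or \<open>M\<close> with a \<open>Y\<close>
  never have weight zero because \<open>s \<notin> \<Gamma>\<close>.
\<close>

subsection \<open>Finitely supported vectors and multilinear forms\<close>

lemma lookup_vscale [simp]: "Poly_Mapping.lookup (vscale c x) p = c * Poly_Mapping.lookup x p"
  unfolding vscale_def by (simp add: map.rep_eq when_def)

lemma vscale_single [simp]: "vscale c (Poly_Mapping.single p a) = Poly_Mapping.single p (c * a)"
  by (rule poly_mapping_eqI) (simp add: lookup_single when_def)

lemma vscale_one [simp]: "vscale 1 x = x"
  by (rule poly_mapping_eqI) simp

lemma keys_vscale_subset: "Poly_Mapping.keys (vscale c x) \<subseteq> Poly_Mapping.keys x"
  by (auto simp: in_keys_iff)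

text \<open>The linear algebra is done over an arbitrary label set; \<open>sv_carrier_eq\<close>
  later specializes it to the labels of the algebra.\<close>

definition fin_span :: "'b set \<Rightarrow> ('b \<Rightarrow>\<^sub>0 'f::field) set" where
  "fin_span S = {x. Poly_Mapping.keys x \<subseteq> S}"

lemma zero_in_fin_span [simp]: "0 \<in> fin_span S"
  by (simp add: fin_span_def)

lemma single_in_fin_span [simp]: "p \<in> S \<Longrightarrow> Poly_Mapping.single p a \<in> fin_span S"
  by (simp add: fin_span_def)

lemma add_in_fin_span: "x \<in> fin_span S \<Longrightarrow> y \<in> fin_span S \<Longrightarrow> x + y \<in> fin_span S"
  unfolding fin_span_def using keys_add by fastforce

lemma vscale_in_fin_span: "x \<in> fin_span S \<Longrightarrow> vscale c x \<in> fin_span S"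
  unfolding fin_span_def using keys_vscale_subset by fastforce

lemma sum_in_fin_span: "(\<And>i. i \<in> I \<Longrightarrow> u i \<in> fin_span S) \<Longrightarrow> (\<Sum>i\<in>I. u i) \<in> fin_span S"
  by (induction I rule: infinite_finite_induct) (auto simp: add_in_fin_span)

lemma poly_mapping_expand:
  "(x :: 'b \<Rightarrow>\<^sub>0 'f::field) =
    (\<Sum>p\<in>Poly_Mapping.keys x. vscale (Poly_Mapping.lookup x p) (Poly_Mapping.single p 1))"
  by (rule poly_mapping_eqI)
    (simp add: lookup_sum lookup_single when_def in_keys_iff)

lemma linear_form_onD:
  assumes "linear_form_on W f"
  shows "x \<in> W \<Longrightarrow> y \<in> W \<Longrightarrow> f (x + y) = f x + f y"
    and "x \<in> W \<Longrightarrow> f (vscale c x) = c * f x"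
  using assms unfolding linear_form_on_def by auto

lemma linear_form_on_zero:
  assumes "linear_form_on (fin_span S) f"
  shows "f 0 = 0"
proof -
  have "f (vscale 0 0) = 0"
    using linear_form_onD(2)[OF assms zero_in_fin_span, of 0] by simp
  moreover have "vscale 0 (0 :: 'a \<Rightarrow>\<^sub>0 'b) = 0"
    by (rule poly_mapping_eqI) simp
  ultimately show ?thesis by simp
qed

lemma linear_form_on_sum:
  assumes "linear_form_on (fin_span S) f" and "\<And>i. i \<in> I \<Longrightarrow> u i \<in> fin_span S"
  shows "f (\<Sum>i\<in>I. u i) = (\<Sum>i\<in>I. f (u i))"
  using assms(2)
proof (induction I rule: infinite_finite_induct)
  case (insert i I)
  then show ?case
    using linear_form_onD(1)[OF assms(1)] by (simp add: sum_in_fin_span)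
qed (simp_all add: linear_form_on_zero[OF assms(1)])

lemma linear_form_on_expand:
  assumes f: "linear_form_on (fin_span S) f" and x: "x \<in> fin_span S"
  shows "f x = (\<Sum>p\<in>Poly_Mapping.keys x. Poly_Mapping.lookup x p * f (Poly_Mapping.single p 1))"
proof -
  have S: "Poly_Mapping.single p 1 \<in> fin_span S" if "p \<in> Poly_Mapping.keys x" for p
    using x that by (auto simp: fin_span_def)
  have "f x = f (\<Sum>p\<in>Poly_Mapping.keys x. vscale (Poly_Mapping.lookup x p) (Poly_Mapping.single p 1))"
    using poly_mapping_expand[of x] by simp
  also have "\<dots> = (\<Sum>p\<in>Poly_Mapping.keys x. f (vscale (Poly_Mapping.lookup x p) (Poly_Mapping.single p 1)))"
    by (rule linear_form_on_sum[OF f]) (use S vscale_in_fin_span in blast)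
  also have "\<dots> = (\<Sum>p\<in>Poly_Mapping.keys x. Poly_Mapping.lookup x p * f (Poly_Mapping.single p 1))"
    by (rule sum.cong[OF refl], rule linear_form_onD(2)[OF f]) (rule S)
  finally show ?thesis .
qed

lemma linear_form_on_eqI:
  assumes "linear_form_on (fin_span S) f" "linear_form_on (fin_span S) g"
    and "\<And>p. p \<in> S \<Longrightarrow> f (Poly_Mapping.single p 1) = g (Poly_Mapping.single p 1)"
    and x: "x \<in> fin_span S"
  shows "f x = g x"
proof -
  have "p \<in> S" if "p \<in> Poly_Mapping.keys x" for p
    using x that by (auto simp: fin_span_def)
  then show ?thesis
    unfolding linear_form_on_expand[OF assms(1) x] linear_form_on_expand[OF assms(2) x]
    using assms(3) by (intro sum.cong) auto
qed

lemma linear_form_on_const_zero: "linear_form_on W (\<lambda>x. 0)"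
  by (simp add: linear_form_on_def)

lemma linear_form_on_add:
  "linear_form_on W f \<Longrightarrow> linear_form_on W g \<Longrightarrow> linear_form_on W (\<lambda>x. f x + g x)"
  by (simp add: linear_form_on_def algebra_simps)

lemma linear_form_on_scale:
  "linear_form_on W f \<Longrightarrow> linear_form_on W (\<lambda>x. c * f x)"
  by (simp add: linear_form_on_def algebra_simps)

section \<open>Linear and bilinear extension from a basis\<close>

definition linear_extend :: "('b \<Rightarrow> 'f) \<Rightarrow> ('b \<Rightarrow>\<^sub>0 'f::field) \<Rightarrow> 'f" where
  "linear_extend f x = (\<Sum>p\<in>Poly_Mapping.keys x. Poly_Mapping.lookup x p * f p)"

text \<open>Labels off the support contribute zero, so a vector sum can be compared with its
  summands over one common finite set even when cancellation shrinks its support.\<close>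

lemma linear_extend_superset:
  assumes "finite A" "Poly_Mapping.keys x \<subseteq> A"
  shows "linear_extend f x = (\<Sum>p\<in>A. Poly_Mapping.lookup x p * f p)"
  unfolding linear_extend_def by (rule sum.mono_neutral_left) (use assms in \<open>auto simp: in_keys_iff\<close>)

lemma linear_form_on_linear_extend: "linear_form_on W (linear_extend f)"
proof -
  have "linear_extend f (x + y) = linear_extend f x + linear_extend f y" for x y
    using linear_extend_superset[of "Poly_Mapping.keys x \<union> Poly_Mapping.keys y" _ f] keys_add[of x y]
    by (simp add: lookup_add sum.distrib algebra_simps)
  moreover have "linear_extend f (vscale c x) = c * linear_extend f x" for c x
    using linear_extend_superset[OF finite_keys keys_vscale_subset, of f c x]
    by (simp add: linear_extend_def sum_distrib_left mult.assoc)
  ultimately show ?thesis by (simp add: linear_form_on_def)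
qed

lemma linear_extend_single [simp]: "linear_extend f (Poly_Mapping.single p a) = a * f p"
  by (simp add: linear_extend_def)

definition bilinear_extend :: "('b \<Rightarrow> 'b \<Rightarrow> 'f) \<Rightarrow> ('b \<Rightarrow>\<^sub>0 'f::field) \<Rightarrow> ('b \<Rightarrow>\<^sub>0 'f) \<Rightarrow> 'f" where
  "bilinear_extend g x y = (\<Sum>p\<in>Poly_Mapping.keys x. \<Sum>q\<in>Poly_Mapping.keys y.
     Poly_Mapping.lookup x p * Poly_Mapping.lookup y q * g p q)"

lemma bilinear_extend_left: "bilinear_extend g x y = linear_extend (\<lambda>p. linear_extend (g p) y) x"
  by (simp add: bilinear_extend_def linear_extend_def sum_distrib_left mult.assoc)

lemma bilinear_extend_right: "bilinear_extend g x y = linear_extend (\<lambda>q. linear_extend (\<lambda>p. g p q) x) y"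
  unfolding bilinear_extend_def linear_extend_def
  by (subst sum.swap) (simp add: sum_distrib_left mult_ac)

lemma bilinear_extend_single [simp]:
  "bilinear_extend g (Poly_Mapping.single p a) (Poly_Mapping.single q b) = a * b * g p q"
  by (simp add: bilinear_extend_left)

lemma linear_form_on_bilinear_extend_left: "linear_form_on W (\<lambda>x. bilinear_extend g x y)"
  by (simp only: bilinear_extend_left linear_form_on_linear_extend)

lemma linear_form_on_bilinear_extend_right: "linear_form_on W (bilinear_extend g x)"
  by (subst bilinear_extend_right[abs_def]) (rule linear_form_on_linear_extend)

lemma bilinear_form_onD:
  assumes "bilinear_form_on W \<psi>"
  shows "y \<in> W \<Longrightarrow> linear_form_on W (\<lambda>x. \<psi> x y)" "x \<in> W \<Longrightarrow> linear_form_on W (\<psi> x)"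
    "x \<notin> W \<or> y \<notin> W \<Longrightarrow> \<psi> x y = 0"
  using assms unfolding bilinear_form_on_def by auto

text \<open>Linearity is used in one argument at a time; outside the span both forms vanish by
  definition, which gives equality as functions on the whole ambient type.\<close>

lemma bilinear_form_on_eqI:
  assumes f: "bilinear_form_on (fin_span S) f" and g: "bilinear_form_on (fin_span S) g"
    and eq: "\<And>p q. p \<in> S \<Longrightarrow> q \<in> S \<Longrightarrow>
      f (Poly_Mapping.single p 1) (Poly_Mapping.single q 1) = g (Poly_Mapping.single p 1) (Poly_Mapping.single q 1)"
  shows "f = g"
proof (intro ext)
  fix x y
  have *: "f (Poly_Mapping.single p 1) y = g (Poly_Mapping.single p 1) y" if "y \<in> fin_span S" "p \<in> S" for p
    by (rule linear_form_on_eqI[OF bilinear_form_onD(2)[OF f] bilinear_form_onD(2)[OF g]])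
      (use that eq in auto)
  show "f x y = g x y"
  proof (cases "x \<in> fin_span S \<and> y \<in> fin_span S")
    case True
    show ?thesis
      by (rule linear_form_on_eqI[OF bilinear_form_onD(1)[OF f] bilinear_form_onD(1)[OF g]])
        (use * True in auto)
  qed (use bilinear_form_onD(3)[OF f] bilinear_form_onD(3)[OF g] in auto)
qed

text \<open>Since the span is closed under sums and multiples, both sides of every linearity
  equation stay in the region where the cut-off form agrees with \<open>g\<close>.\<close>

lemma bilinear_form_on_restrict:
  assumes "\<And>x y. x \<in> fin_span S \<Longrightarrow> y \<in> fin_span S \<Longrightarrow> \<psi> x y = g x y"
    and "\<And>x y. x \<notin> fin_span S \<or> y \<notin> fin_span S \<Longrightarrow> \<psi> x y = 0"
    and "\<And>y. y \<in> fin_span S \<Longrightarrow> linear_form_on (fin_span S) (\<lambda>x. g x y)"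
    and "\<And>x. x \<in> fin_span S \<Longrightarrow> linear_form_on (fin_span S) (g x)"
  shows "bilinear_form_on (fin_span S) \<psi>"
  using assms unfolding bilinear_form_on_def linear_form_on_def
  by (simp add: add_in_fin_span vscale_in_fin_span)

lemma bilinear_form_on_add:
  "bilinear_form_on W f \<Longrightarrow> bilinear_form_on W g \<Longrightarrow> bilinear_form_on W (\<lambda>x y. f x y + g x y)"
  by (auto simp: bilinear_form_on_def intro!: linear_form_on_add)

lemma bilinear_form_on_scale:
  "bilinear_form_on W f \<Longrightarrow> bilinear_form_on W (\<lambda>x y. c * f x y)"
  by (auto simp: bilinear_form_on_def intro!: linear_form_on_scale)

subsection \<open>Operations on cohomology classes\<close>

lemma linear_form_on_in_coboundaries2:
  "linear_form_on W f \<Longrightarrow> coboundary2 W br f \<in> coboundaries2 W br"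
  by (auto simp: coboundaries2_def)

lemma coboundaries2_add:
  assumes "\<beta> \<in> coboundaries2 W br" "\<beta>' \<in> coboundaries2 W br"
  shows "(\<lambda>x y. \<beta> x y + \<beta>' x y) \<in> coboundaries2 W br"
proof -
  obtain f g where fg: "linear_form_on W f" "linear_form_on W g"
    "\<beta> = coboundary2 W br f" "\<beta>' = coboundary2 W br g"
    using assms by (auto simp: coboundaries2_def)
  then have "(\<lambda>x y. \<beta> x y + \<beta>' x y) = coboundary2 W br (\<lambda>x. f x + g x)"
    by (auto simp: coboundary2_def fun_eq_iff)
  then show ?thesis
    using linear_form_on_add[OF fg(1,2)] linear_form_on_in_coboundaries2 by metis
qed

lemma coboundaries2_scale:
  assumes "\<beta> \<in> coboundaries2 W br"
  shows "(\<lambda>x y. c * \<beta> x y) \<in> coboundaries2 W br"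
proof -
  obtain f where f: "linear_form_on W f" "\<beta> = coboundary2 W br f"
    using assms by (auto simp: coboundaries2_def)
  then have "(\<lambda>x y. c * \<beta> x y) = coboundary2 W br (\<lambda>x. c * f x)"
    by (auto simp: coboundary2_def fun_eq_iff)
  then show ?thesis
    using linear_form_on_scale[OF f(1)] linear_form_on_in_coboundaries2 by metis
qed

lemma coboundaries2_zero: "(\<lambda>x y. 0) \<in> coboundaries2 W br"
  using linear_form_on_in_coboundaries2[OF linear_form_on_const_zero, of W br]
  by (simp add: coboundary2_def)

lemma coboundaries2_diff:
  assumes "\<beta> \<in> coboundaries2 W br" "\<beta>' \<in> coboundaries2 W br"
  shows "(\<lambda>x y. \<beta> x y - \<beta>' x y) \<in> coboundaries2 W br"
  using coboundaries2_add[OF assms(1) coboundaries2_scale[OF assms(2), of "-1"]] by simp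

lemma cocycles2_add:
  assumes "\<psi> \<in> cocycles2 W br" "\<psi>' \<in> cocycles2 W br"
  shows "(\<lambda>x y. \<psi> x y + \<psi>' x y) \<in> cocycles2 W br"
proof -
  have "(\<psi> x (br y z) + \<psi>' x (br y z)) + (\<psi> y (br z x) + \<psi>' y (br z x)) + (\<psi> z (br x y) + \<psi>' z (br x y))
     = (\<psi> x (br y z) + \<psi> y (br z x) + \<psi> z (br x y)) + (\<psi>' x (br y z) + \<psi>' y (br z x) + \<psi>' z (br x y))" for x y z
    by simp
  then show ?thesis
    using assms bilinear_form_on_add[of W \<psi> \<psi>'] unfolding cocycles2_def mem_Collect_eq
    by (metis (no_types, lifting) add.right_neutral minus_add_distrib)
qed

lemma cocycles2_scale:
  assumes "\<psi> \<in> cocycles2 W br"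
  shows "(\<lambda>x y. c * \<psi> x y) \<in> cocycles2 W br"
proof -
  have "c * \<psi> x (br y z) + c * \<psi> y (br z x) + c * \<psi> z (br x y)
     = c * (\<psi> x (br y z) + \<psi> y (br z x) + \<psi> z (br x y))" for x y z
    by (simp add: algebra_simps)
  then show ?thesis
    using assms bilinear_form_on_scale[of W \<psi> c] unfolding cocycles2_def mem_Collect_eq
    by (metis (no_types, lifting) mult_zero_right mult_minus_right)
qed

lemma cocycles2_diff:
  assumes "\<psi> \<in> cocycles2 W br" "\<psi>' \<in> cocycles2 W br"
  shows "(\<lambda>x y. \<psi> x y - \<psi>' x y) \<in> cocycles2 W br"
  using cocycles2_add[OF assms(1) cocycles2_scale[OF assms(2), of "-1"]] by simp

lemma mem_coh_class:
  "\<psi>' \<in> coh_class W br \<psi> \<longleftrightarrow>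
    \<psi> \<in> cocycles2 W br \<and> \<psi>' \<in> cocycles2 W br \<and> (\<lambda>x y. \<psi> x y - \<psi>' x y) \<in> coboundaries2 W br"
  by (simp add: coh_class_def cohomologous_def)

lemma coh_class_refl: "\<psi> \<in> cocycles2 W br \<Longrightarrow> \<psi> \<in> coh_class W br \<psi>"
  by (simp add: mem_coh_class coboundaries2_zero)

text \<open>Closure of the coboundaries under sums and differences carries membership from one coset
  to the other.\<close>

lemma coh_class_eq_iff:
  assumes "\<psi> \<in> cocycles2 W br" "\<psi>' \<in> cocycles2 W br"
  shows "coh_class W br \<psi> = coh_class W br \<psi>' \<longleftrightarrow> (\<lambda>x y. \<psi> x y - \<psi>' x y) \<in> coboundaries2 W br"
proof
  assume "coh_class W br \<psi> = coh_class W br \<psi>'"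
  then show "(\<lambda>x y. \<psi> x y - \<psi>' x y) \<in> coboundaries2 W br"
    using coh_class_refl[OF assms(2)] by (auto simp: mem_coh_class)
next
  assume *: "(\<lambda>x y. \<psi> x y - \<psi>' x y) \<in> coboundaries2 W br"
  have "(\<lambda>x y. \<psi> x y - \<phi> x y) \<in> coboundaries2 W br"
    if "(\<lambda>x y. \<psi>' x y - \<phi> x y) \<in> coboundaries2 W br" for \<phi>
    using coboundaries2_add[OF * that] by simp
  moreover have "(\<lambda>x y. \<psi>' x y - \<phi> x y) \<in> coboundaries2 W br"
    if "(\<lambda>x y. \<psi> x y - \<phi> x y) \<in> coboundaries2 W br" for \<phi>
    using coboundaries2_diff[OF that *] by simp
  ultimately show "coh_class W br \<psi> = coh_class W br \<psi>'"
    using assms by (auto simp: mem_coh_class)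
qed

lemma H2_eq: "H2 W br = coh_class W br ` cocycles2 W br"
  by (auto simp: H2_def quotient_def coh_class_def)

lemma H2_add_coh_class:
  assumes "\<psi> \<in> cocycles2 W br" "\<psi>' \<in> cocycles2 W br"
  shows "H2_add (coh_class W br \<psi>) (coh_class W br \<psi>') = coh_class W br (\<lambda>x y. \<psi> x y + \<psi>' x y)"
proof (intro equalityI subsetI)
  fix \<phi> assume "\<phi> \<in> H2_add (coh_class W br \<psi>) (coh_class W br \<psi>')"
  then obtain \<chi> \<chi>' where "\<chi> \<in> coh_class W br \<psi>" "\<chi>' \<in> coh_class W br \<psi>'" "\<phi> = (\<lambda>x y. \<chi> x y + \<chi>' x y)"
    by (auto simp: H2_add_def)
  then show "\<phi> \<in> coh_class W br (\<lambda>x y. \<psi> x y + \<psi>' x y)"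
    using coboundaries2_add[of "\<lambda>x y. \<psi> x y - \<chi> x y" W br "\<lambda>x y. \<psi>' x y - \<chi>' x y"]
    by (simp add: mem_coh_class cocycles2_add algebra_simps)
next
  fix \<phi> assume \<phi>: "\<phi> \<in> coh_class W br (\<lambda>x y. \<psi> x y + \<psi>' x y)"
  \<comment> \<open>Splits \<phi> with the representative \<psi>' itself as second summand, so that
    the whole discrepancy goes into the first.\<close>
  then have "(\<lambda>x y. \<phi> x y - \<psi>' x y) \<in> coh_class W br \<psi>"
    using assms by (simp add: mem_coh_class cocycles2_diff algebra_simps)
  then show "\<phi> \<in> H2_add (coh_class W br \<psi>) (coh_class W br \<psi>')"
    unfolding H2_add_def using coh_class_refl[OF assms(2)]
    by (intro CollectI exI[of _ "\<lambda>x y. \<phi> x y - \<psi>' x y"] exI[of _ \<psi>']) simp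
qed

text \<open>For an abstract \<open>br\<close> a coboundary may fail to be a cocycle; the inclusion
  \<open>cb\<close> keeps the coboundary added in \<open>H2_scale\<close> among the
  cocycles.\<close>

lemma H2_scale_coh_class:
  assumes "\<psi> \<in> cocycles2 W br" and cb: "coboundaries2 W br \<subseteq> cocycles2 W br"
  shows "H2_scale W br c (coh_class W br \<psi>) = coh_class W br (\<lambda>x y. c * \<psi> x y)"
proof (intro equalityI subsetI)
  fix \<phi> assume "\<phi> \<in> H2_scale W br c (coh_class W br \<psi>)"
  then obtain \<chi> \<beta> where *: "\<chi> \<in> coh_class W br \<psi>" "\<beta> \<in> coboundaries2 W br"
    "\<phi> = (\<lambda>x y. c * \<chi> x y + \<beta> x y)"
    by (auto simp: H2_scale_def)
  have "(\<lambda>x y. c * (\<psi> x y - \<chi> x y) - \<beta> x y) \<in> coboundaries2 W br"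
    by (rule coboundaries2_diff[OF coboundaries2_scale *(2)]) (use *(1) in \<open>simp add: mem_coh_class\<close>)
  then have "(\<lambda>x y. c * \<psi> x y - \<phi> x y) \<in> coboundaries2 W br"
    by (simp add: * algebra_simps)
  then show "\<phi> \<in> coh_class W br (\<lambda>x y. c * \<psi> x y)"
    using * assms by (auto simp: mem_coh_class intro!: cocycles2_add cocycles2_scale)
next
  fix \<phi> assume \<phi>: "\<phi> \<in> coh_class W br (\<lambda>x y. c * \<psi> x y)"
  \<comment> \<open>Class membership controls \<open>c * \<psi> - \<phi>\<close>, whereas the
    coboundary to be added is its negative; hence the factor -1.\<close>
  then have "(\<lambda>x y. -1 * (c * \<psi> x y - \<phi> x y)) \<in> coboundaries2 W br"
    by (intro coboundaries2_scale) (simp add: mem_coh_class)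
  then show "\<phi> \<in> H2_scale W br c (coh_class W br \<psi>)"
    unfolding H2_scale_def using coh_class_refl[OF assms(1)]
    by (intro CollectI exI[of _ \<psi>] exI[of _ "\<lambda>x y. -1 * (c * \<psi> x y - \<phi> x y)"]) simp
qed

subsection \<open>Functional equations\<close>

text \<open>Once a defect is known to be additive in the loop degree, only one unknown, its value at
  1, remains to be killed.\<close>

lemma additive_int_function:
  fixes g :: "int \<Rightarrow> 'a::ring_1"
  assumes "\<And>j k. g (j + k) = g j + g k"
  shows "g k = of_int k * g 1"
proof -
  interpret g: Modules.additive g by unfold_locales (rule assms)
  have *: "g (int n) = of_nat n * g 1" for n
    by (induction n) (auto simp: g.zero assms algebra_simps)
  show ?thesis
  proof (cases "0 \<le> k")
    case True
    then show ?thesis using *[of "nat k"] by simp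
  next
    case False
    then show ?thesis using *[of "nat (- k)"] by (simp add: g.minus of_int_minus)
  qed
qed

text \<open>The element \<open>e\<close> serves as step size and interpolation point in the
  functional equations; in characteristic 0 its nonzero integer multiples do not vanish.\<close>

locale nontrivial_additive_subgroup =
  fixes \<Gamma> :: "'f::field_char_0 set" and e :: 'f
  assumes zero [simp]: "0 \<in> \<Gamma>"
    and add [simp]: "\<And>\<alpha> \<beta>. \<alpha> \<in> \<Gamma> \<Longrightarrow> \<beta> \<in> \<Gamma> \<Longrightarrow> \<alpha> + \<beta> \<in> \<Gamma>"
    and uminus [simp]: "\<And>\<alpha>. \<alpha> \<in> \<Gamma> \<Longrightarrow> - \<alpha> \<in> \<Gamma>"
    and e [simp]: "e \<in> \<Gamma>" "e \<noteq> 0"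
begin

lemma double_e [simp]: "2 * e \<in> \<Gamma>"
  using add[OF e(1) e(1)] by (simp only: mult_2)

text \<open>Going from \<alpha> to \<alpha> + 2e directly and through \<alpha> + e gives two
  relations between the end values, compatible only if \<open>a \<alpha> = 0\<close>.\<close>

lemma witt_equation_vanish:
  assumes a: "\<And>\<alpha> \<beta>. \<alpha> \<in> \<Gamma> \<Longrightarrow> \<beta> \<in> \<Gamma> \<Longrightarrow>
      (\<alpha> - \<beta>) * a (\<alpha> + \<beta>) = (\<alpha> + 2 * \<beta>) * a \<alpha> - (2 * \<alpha> + \<beta>) * a \<beta>"
    and "a e = 0" "a (2 * e) = 0" and \<alpha>: "\<alpha> \<in> \<Gamma>"
  shows "a \<alpha> = 0"
proof -
  have 1: "(\<alpha> - e) * a (\<alpha> + e) = (\<alpha> + 2 * e) * a \<alpha>"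
    using a[OF \<alpha> e(1)] assms by simp
  have 2: "(\<alpha> - 2 * e) * a (\<alpha> + 2 * e) = (\<alpha> + 4 * e) * a \<alpha>"
    using a[OF \<alpha> double_e] assms by simp
  have 3: "\<alpha> * a (\<alpha> + 2 * e) = (\<alpha> + 3 * e) * a (\<alpha> + e)"
    using a[OF add[OF \<alpha> e(1)] e(1)] assms by (simp add: algebra_simps)
  \<comment> \<open>\<open>(\<alpha>^2 - 4 e^2) (\<alpha> + 3 e) - \<alpha> (\<alpha> - e) (\<alpha> + 4 e) = - 12 e^3\<close>, so no division by a possibly
    vanishing factor is needed\<close>
  have "(-12 * e ^ 3) * a \<alpha> = 0"
    using 1 2 3 by algebra
  then show ?thesis by simp
qed

text \<open>The hypothesis is the Jacobi identity for three \<open>L\<close> of weights \<alpha>,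
  \<beta>, -(\<alpha> + \<beta>), with an odd pairing function. Both \<alpha>^3 and \<alpha> solve
  it; subtracting the combination with the right values at e and 2e leaves a solution that
  vanishes.\<close>

lemma witt_equation_solution:
  assumes a: "\<And>\<alpha> \<beta>. \<alpha> \<in> \<Gamma> \<Longrightarrow> \<beta> \<in> \<Gamma> \<Longrightarrow>
      (\<alpha> - \<beta>) * a (\<alpha> + \<beta>) = (\<alpha> + 2 * \<beta>) * a \<alpha> - (2 * \<alpha> + \<beta>) * a \<beta>"
  shows "\<exists>c d. \<forall>\<alpha>\<in>\<Gamma>. a \<alpha> = c * \<alpha> ^ 3 + d * \<alpha>"
proof (intro exI ballI)
  fix \<alpha> assume \<alpha>: "\<alpha> \<in> \<Gamma>"
  \<comment> \<open>Solution of the system c e^3 + d e = a(e), 8 c e^3 + 2 d e = a(2e), whose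
    determinant is -6 e^4.\<close>
  let ?c = "(a (2 * e) - 2 * a e) / (6 * e ^ 3)" and ?d = "(8 * a e - a (2 * e)) / (6 * e)"
  have cd: "?c * e ^ 3 + ?d * e = a e" "?c * (2 * e) ^ 3 + ?d * (2 * e) = a (2 * e)"
    by (simp_all add: field_simps power_mult_distrib)
  define c d where "c = ?c" and "d = ?d"
  let ?a = "\<lambda>\<alpha>. a \<alpha> - (c * \<alpha> ^ 3 + d * \<alpha>)"
  have "?a \<alpha> = 0"
  proof (rule witt_equation_vanish[OF _ _ _ \<alpha>])
    fix \<alpha> \<beta> assume "\<alpha> \<in> \<Gamma>" "\<beta> \<in> \<Gamma>"
    from a[OF this] show "(\<alpha> - \<beta>) * ?a (\<alpha> + \<beta>) = (\<alpha> + 2 * \<beta>) * ?a \<alpha> - (2 * \<alpha> + \<beta>) * ?a \<beta>"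
      by algebra
  qed (use cd in \<open>simp_all add: c_def d_def\<close>)
  then show "a \<alpha> = ?c * \<alpha> ^ 3 + ?d * \<alpha>" by (simp add: c_def d_def)
qed

text \<open>Again two routes from \<alpha> to \<alpha> + 2e are compared. Here a factor \<alpha> +
  2e survives, so the weight -2e is treated separately.\<close>

lemma function_module_equation_vanish:
  assumes b: "\<And>\<alpha> \<beta>. \<alpha> \<in> \<Gamma> \<Longrightarrow> \<beta> \<in> \<Gamma> \<Longrightarrow> (\<alpha> + \<beta>) * (b \<alpha> - b \<beta>) = (\<alpha> - \<beta>) * b (\<alpha> + \<beta>)"
    and "b e = 0" "b (- e) = 0" and \<alpha>: "\<alpha> \<in> \<Gamma>"
  shows "b \<alpha> = 0"
proof -
  have 0: "b (2 * e) = 0"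
    using b[OF double_e uminus[OF e(1)]] assms by simp
  have "b (- (2 * e)) = 0"
    using b[OF uminus[OF double_e] e(1)] assms by simp
  moreover have "b \<alpha> = 0" if "\<alpha> + 2 * e \<noteq> 0"
  proof -
    have 1: "(\<alpha> + e) * b \<alpha> = (\<alpha> - e) * b (\<alpha> + e)"
      using b[OF \<alpha> e(1)] assms by simp
    have 2: "(\<alpha> + 2 * e) * b \<alpha> = (\<alpha> - 2 * e) * b (\<alpha> + 2 * e)"
      using b[OF \<alpha> double_e] 0 by simp
    have 3: "(\<alpha> + 2 * e) * b (\<alpha> + e) = \<alpha> * b (\<alpha> + 2 * e)"
      using b[OF add[OF \<alpha> e(1)] e(1)] assms by (simp add: algebra_simps)
    \<comment> \<open>Eliminating the shifted values rests on (\<alpha> - 2e)(\<alpha> + e) -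
      \<alpha>(\<alpha> - e) = -2 e^2.\<close>
    have "(2 * e ^ 2 * (\<alpha> + 2 * e)) * b \<alpha> = 0"
      using 1 2 3 by algebra
    then show ?thesis using that by simp
  qed
  ultimately show ?thesis by (metis eq_neg_iff_add_eq_0)
qed

text \<open>The hypothesis is the Jacobi identity for \<open>L\<close>, \<open>L\<close>,
  \<open>M\<close> at total weight zero. The odd and even parts of the data at e and -e fix the
  coefficients of the solutions \<alpha> and \<alpha>^2.\<close>

lemma function_module_equation_solution:
  assumes b: "\<And>\<alpha> \<beta>. \<alpha> \<in> \<Gamma> \<Longrightarrow> \<beta> \<in> \<Gamma> \<Longrightarrow> (\<alpha> + \<beta>) * (b \<alpha> - b \<beta>) = (\<alpha> - \<beta>) * b (\<alpha> + \<beta>)"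
  shows "\<exists>d d'. \<forall>\<alpha>\<in>\<Gamma>. b \<alpha> = d * \<alpha> + d' * \<alpha> ^ 2"
proof (intro exI ballI)
  fix \<alpha> assume \<alpha>: "\<alpha> \<in> \<Gamma>"
  let ?d = "(b e - b (- e)) / (2 * e)" and ?d' = "(b e + b (- e)) / (2 * e ^ 2)"
  have cd: "?d * e + ?d' * e ^ 2 = b e" "?d * (- e) + ?d' * (- e) ^ 2 = b (- e)"
    by (simp_all add: field_simps)
  define d d' where "d = ?d" and "d' = ?d'"
  let ?b = "\<lambda>\<alpha>. b \<alpha> - (d * \<alpha> + d' * \<alpha> ^ 2)"
  have "?b \<alpha> = 0"
  proof (rule function_module_equation_vanish[OF _ _ _ \<alpha>])
    fix \<alpha> \<beta> assume "\<alpha> \<in> \<Gamma>" "\<beta> \<in> \<Gamma>"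
    from b[OF this] show "(\<alpha> + \<beta>) * (?b \<alpha> - ?b \<beta>) = (\<alpha> - \<beta>) * ?b (\<alpha> + \<beta>)"
      by algebra
  qed (use cd in \<open>simp_all add: d_def d'_def\<close>)
  then show "b \<alpha> = ?d * \<alpha> + ?d' * \<alpha> ^ 2" by (simp add: d_def d'_def)
qed

text \<open>\<open>A \<alpha> i j\<close> models the value on \<open>Lb \<alpha> i\<close> and
  \<open>Lb (- \<alpha>) j\<close>. First the distribution of the total degree over the two entries
  is shown not to matter; the remaining function of \<alpha> then solves the Witt equation.\<close>

lemma LL_pairing_form:
  fixes A :: "'f \<Rightarrow> int \<Rightarrow> int \<Rightarrow> 'f"
  assumes anti: "\<And>\<alpha> i j. \<alpha> \<in> \<Gamma> \<Longrightarrow> A \<alpha> i j = - A (- \<alpha>) j i"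
    and jac: "\<And>\<alpha> \<beta> \<gamma> i j k. \<alpha> \<in> \<Gamma> \<Longrightarrow> \<beta> \<in> \<Gamma> \<Longrightarrow> \<gamma> \<in> \<Gamma> \<Longrightarrow> \<alpha> + \<beta> + \<gamma> = 0 \<Longrightarrow>
      (\<gamma> - \<beta>) * A \<alpha> i (j + k) + (\<alpha> - \<gamma>) * A \<beta> j (k + i) + (\<beta> - \<alpha>) * A \<gamma> k (i + j) = 0"
  shows "\<exists>c d. \<forall>\<alpha>\<in>\<Gamma>. \<forall>i j. A \<alpha> i j = c (i + j) * \<alpha> ^ 3 + d (i + j) * \<alpha>"
proof -
  define u where "u n k = A 0 k (n - k)" for n k
  have shift: "A \<alpha> i (j + k) - A \<alpha> (i + k) j = 2 * u (i + j + k) k" if "\<alpha> \<in> \<Gamma>" "\<alpha> \<noteq> 0" for \<alpha> i j k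
  proof -
    \<comment> \<open>Jacobi identity with third weight zero: moving degree k between the entries
      costs twice the value at weight zero.\<close>
    have "\<alpha> * (A \<alpha> i (j + k) - A \<alpha> (k + i) j - 2 * A 0 k (i + j)) = 0"
      using jac[of \<alpha> "- \<alpha>" 0 i j k] anti[of "- \<alpha>" j "k + i"] that by (simp add: algebra_simps)
    then have "A \<alpha> i (j + k) - A \<alpha> (k + i) j - 2 * A 0 k (i + j) = 0"
      using that by simp
    then show ?thesis by (simp add: u_def algebra_simps)
  qed
  have "u n (j + k) = u n j + u n k" for n j k
  proof -
    \<comment> \<open>At total degree n, moving degree j + k at once must cost as much as moving j
      and then k.\<close>
    have "2 * u n (j + k) = 2 * (u n j + u n k)"
      using shift[of e 0 "n - j - k" "j + k"] shift[of e 0 "n - j" j] shift[of e j "n - j - k" k]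
      by (simp add: algebra_simps)
    then show ?thesis by (simp only: mult_cancel_left) simp
  qed
  then have u: "u n k = of_int k * u n 1" for n k
    by (rule additive_int_function)
  have A: "A \<alpha> i j = A \<alpha> 0 (i + j) - 2 * of_int i * u (i + j) 1" if "\<alpha> \<in> \<Gamma>" "\<alpha> \<noteq> 0" for \<alpha> i j
    using shift[OF that, of 0 j i] u[of "i + j" i] by (simp add: algebra_simps)
  have "u n 1 = 0" for n
  proof -
    have "- (e + e) \<in> \<Gamma>" by (intro uminus add) auto
    \<comment> \<open>For weights e, e, -2e the third term drops out, so degrees 1 and -1 force
      \<open>A e 1 (n - 1) = A e (-1) (n + 1)\<close>; by \<open>A\<close> these differ by
      \<open>4 * u n 1\<close>.\<close>
    from jac[OF e(1) e(1) this, of 1 "-1" n] jac[OF e(1) e(1) this, of 0 0 n]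
      A[OF e(1) e(2), of 1 "n - 1"] A[OF e(1) e(2), of "- 1" "n + 1"] 
    have "e * u n 1 = 0" by (simp add: algebra_simps)
    then show ?thesis by simp
  qed
  then have u0: "u n k = 0" for n k using u[of n k] by simp
  have A0: "A 0 i j = 0" for i j
    using u0[of "i + j" i] by (simp add: u_def)
  then have A: "A \<alpha> i j = A \<alpha> 0 (i + j)" if "\<alpha> \<in> \<Gamma>" for \<alpha> i j
    using A[OF that] u0 A0 by (cases "\<alpha> = 0") auto
  have odd: "A (- \<alpha>) 0 n = - A \<alpha> 0 n" if "\<alpha> \<in> \<Gamma>" for \<alpha> n
    using anti[OF that, of 0 n] A[of "- \<alpha>" n 0] that by simp
  have "\<exists>c d. \<forall>\<alpha>\<in>\<Gamma>. A \<alpha> 0 n = c * \<alpha> ^ 3 + d * \<alpha>" for n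
  proof (rule witt_equation_solution)
    fix \<alpha> \<beta> assume *: "\<alpha> \<in> \<Gamma>" "\<beta> \<in> \<Gamma>"
    then show "(\<alpha> - \<beta>) * A (\<alpha> + \<beta>) 0 n = (\<alpha> + 2 * \<beta>) * A \<alpha> 0 n - (2 * \<alpha> + \<beta>) * A \<beta> 0 n"
      using jac[OF * uminus[OF add[OF *]], of 0 0 n] odd[OF add[OF *], of n]
        A[OF uminus[OF add[OF *]], of n 0]
      by (simp add: algebra_simps)
  qed
  then obtain c d where "\<And>n. \<forall>\<alpha>\<in>\<Gamma>. A \<alpha> 0 n = c n * \<alpha> ^ 3 + d n * \<alpha>"
    by metis
  then show ?thesis using A by metis
qed

text \<open>\<open>B\<close> models the pairing of \<open>L\<close> with \<open>M\<close>,
  \<open>C\<close> that of \<open>Y\<close> with \<open>Y\<close>, and \<Omega> the coset of the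
  \<open>Y\<close> weights. They are solved together: \<open>jacB\<close> alone admits a term
  quadratic in \<alpha>, which only the coupling \<open>jacC\<close> excludes.\<close>

lemma LM_YY_pairing_form:
  fixes B C :: "'f \<Rightarrow> int \<Rightarrow> int \<Rightarrow> 'f"
  assumes s: "s \<noteq> 0" and \<Omega>: "\<And>p. p \<in> \<Omega> \<longleftrightarrow> p - s \<in> \<Gamma>" "0 \<notin> \<Omega>" and e2s: "e = 2 * s"
    and anti: "\<And>p i j. p \<in> \<Omega> \<Longrightarrow> C p i j = - C (- p) j i"
    and jacB: "\<And>\<alpha> \<beta> i j k. \<alpha> \<in> \<Gamma> \<Longrightarrow> \<beta> \<in> \<Gamma> \<Longrightarrow>
      (\<alpha> + \<beta>) * (B \<alpha> i (j + k) - B \<beta> j (i + k)) + (\<beta> - \<alpha>) * B (\<alpha> + \<beta>) (i + j) k = 0"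
    and jacC: "\<And>\<alpha> p q i j k. \<alpha> \<in> \<Gamma> \<Longrightarrow> p \<in> \<Omega> \<Longrightarrow> q \<in> \<Omega> \<Longrightarrow> \<alpha> + p + q = 0 \<Longrightarrow>
      (q - p) * B \<alpha> i (j + k) - (q - \<alpha> / 2) * C p j (k + i) + (p - \<alpha> / 2) * C q k (i + j) = 0"
  shows "\<exists>d. (\<forall>\<alpha>\<in>\<Gamma>. \<forall>i j. B \<alpha> i j = d (i + j) * \<alpha>) \<and> (\<forall>p\<in>\<Omega>. \<forall>i j. C p i j = 2 * d (i + j) * p)"
proof -
  define v where "v n k = B 0 k (n - k)" for n k
  have pm: "- p \<in> \<Omega>" if "p \<in> \<Omega>" for p
  proof -
    have "- (p - s) + - e \<in> \<Gamma>" using that \<Omega> by (intro add uminus) auto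
    then show ?thesis using e2s \<Omega>(1) by (simp add: algebra_simps)
  qed
  have sO: "s \<in> \<Omega>" using \<Omega>(1)[of s] by simp
  have C: "C p j (k + i) - C p (i + j) k = 2 * v (i + j + k) i" if "p \<in> \<Omega>" for p i j k
  proof -
    \<comment> \<open>Jacobi identity for \<open>L\<close> of weight zero and \<open>Y\<close> of
      weights p and -p.\<close>
    have "p * (C p j (k + i) - C p (i + j) k - 2 * B 0 i (j + k)) = 0"
      using jacC[OF zero that pm[OF that], of i j k] anti[OF pm[OF that], of k "i + j"]
      by (simp add: algebra_simps)
    moreover have "p \<noteq> 0" using that \<Omega>(2) by auto
    ultimately have "C p j (k + i) - C p (i + j) k - 2 * B 0 i (j + k) = 0" by simp
    then show ?thesis by (simp add: v_def algebra_simps)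
  qed
  have "v n (j + k) = v n j + v n k" for n j k
  proof -
    have "2 * v n (j + k) = 2 * (v n j + v n k)"
      using C[OF sO, of 0 "n - j - k" "j + k"] C[OF sO, of 0 "n - j" j] C[OF sO, of j "n - j - k" k]
      by (simp add: algebra_simps)
    then show ?thesis by (simp only: mult_cancel_left) simp
  qed
  then have v: "v n k = of_int k * v n 1" for n k
    by (rule additive_int_function)
  have B: "B \<alpha> i (j + k) - B \<alpha> (i + j) k = v (i + j + k) j" if "\<alpha> \<in> \<Gamma>" "\<alpha> \<noteq> 0" for \<alpha> i j k
  proof -
    have "\<alpha> * (B \<alpha> i (j + k) - B \<alpha> (i + j) k - B 0 j (i + k)) = 0"
      using jacB[OF that(1) zero, of i j k] by (simp add: algebra_simps)
    then have "B \<alpha> i (j + k) - B \<alpha> (i + j) k - B 0 j (i + k) = 0"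
      using that by simp
    then show ?thesis by (simp add: v_def algebra_simps)
  qed
  have B1: "B \<alpha> i j = B \<alpha> 0 (i + j) - of_int i * v (i + j) 1" if "\<alpha> \<in> \<Gamma>" "\<alpha> \<noteq> 0" for \<alpha> i j
    using B[OF that, of 0 i j] v[of "i + j" i] by (simp add: algebra_simps)
  have "v n 1 = 0" for n
  proof -
    \<comment> \<open>Equal weights e, e remove the last term of \<open>jacB\<close>, so degrees 1
      and 0 give equal values of \<open>B e\<close>; by \<open>B1\<close> they differ by
      \<open>v n 1\<close>.\<close>
    have "e * v n 1 = 0"
      using jacB[OF e(1) e(1), of 1 0 "n - 1"] B1[OF e, of 1 "n - 1"]
      by (simp add: algebra_simps)
    then show ?thesis by simp
  qed
  then have v0: "v n k = 0" for n k using v[of n k] by simp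
  have B0: "B 0 i j = 0" for i j
    using v0[of "i + j" i] by (simp add: v_def)
  then have B1: "B \<alpha> i j = B \<alpha> 0 (i + j)" if "\<alpha> \<in> \<Gamma>" for \<alpha> i j
    using B1[OF that] v0 B0 by (cases "\<alpha> = 0") auto
  have C1: "C p i j = C p 0 (i + j)" if "p \<in> \<Omega>" for p i j
    using C[OF that, of 0 j i] v0 by (simp add: algebra_simps)
  have C_odd: "C (- p) 0 n = - C p 0 n" if "p \<in> \<Omega>" for p n
    using anti[OF that, of 0 n] C1[OF pm[OF that], of n 0] by simp
  have "\<exists>d d'. \<forall>\<alpha>\<in>\<Gamma>. B \<alpha> 0 n = d * \<alpha> + d' * \<alpha> ^ 2" for n
    by (rule function_module_equation_solution)
      (use jacB[of _ _ 0 0 n] in \<open>simp add: algebra_simps\<close>)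
  then obtain d d' where d: "\<And>n. \<forall>\<alpha>\<in>\<Gamma>. B \<alpha> 0 n = d n * \<alpha> + d' n * \<alpha> ^ 2"
    by metis
  \<comment> \<open>The deviation of \<open>C\<close> from its expected value; in terms of it the
    coefficient \<open>d\<close> cancels from \<open>jacC\<close> and only \<open>d'\<close> is
    left.\<close>
  define c where "c p n = C p 0 n - 2 * d n * p" for p n
  have c_odd: "c (- p) n = - c p n" if "p \<in> \<Omega>" for p n
    using C_odd[OF that] by (simp add: c_def)
  have c: "2 * (q - p) * (d' n * (p + q) ^ 2) = (3 * q + p) * c p n - (3 * p + q) * c q n"
    if "p \<in> \<Omega>" "q \<in> \<Omega>" for p q n
  proof -
    have "(p - s) + (q - s) + e \<in> \<Gamma>" using that \<Omega> by (intro add) auto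
    then have "- (p + q) \<in> \<Gamma>" using e2s uminus[of "p + q"] by (simp add: algebra_simps)
    note * = this jacC[OF this that, of 0 0 n] d
    \<comment> \<open>Naming the half sum leaves a division-free identity for
      \<open>algebra\<close>.\<close>
    define h where "h = (p + q) / 2"
    have h: "2 * h = p + q" by (simp add: h_def)
    have h': "- (p + q) / 2 = - h" unfolding h_def by (rule minus_divide_left[symmetric])
    have "(q - p) * (d n * - (p + q) + d' n * (- (p + q)) ^ 2) - (q - - h) * C p 0 n
       + (p - - h) * C q 0 n = 0"
      using * C1[OF that(2), of n 0] unfolding h' by simp
    then show ?thesis using h unfolding c_def by algebra
  qed
  have s3: "3 * s \<in> \<Omega>" "- s \<in> \<Omega>" "- (3 * s) \<in> \<Omega>"
    using \<Omega>(1)[of "3 * s"] e(1) e2s pm sO by (auto simp: algebra_simps)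
  have d'0: "d' n = 0" and cs: "c s n = 0" and c3s: "c (3 * s) n = 0" for n
  proof -
    \<comment> \<open>The pairs (-s, 3s) and (s, -3s) make the coefficient 3p + q vanish. By oddness
      they equate the same quantity with both -c(s) and c(s), up to the common factor 8s.\<close>
    have 1: "8 * s * (d' n * (2 * s) ^ 2) = 8 * s * - c s n"
      using c[OF s3(2,1), of n] c_odd[OF sO, of n] by simp
    have 2: "8 * s * (d' n * (2 * s) ^ 2) = 8 * s * c s n"
      using c[OF sO s3(3), of n] by (simp add: algebra_simps)
    from 1 2 have "16 * s * c s n = 0" by algebra
    with s show "c s n = 0" by simp
    with 1 s show "d' n = 0" by simp
    show "c (3 * s) n = 0"
      using c[OF sO s3(1), of n] s \<open>c s n = 0\<close> \<open>d' n = 0\<close> by simp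
  qed
  have c0: "c q n = 0" if "q \<in> \<Omega>" for q n
  \<comment> \<open>Pairing q with s determines c(q) except where its coefficient vanishes; there
    oddness and c(3s) = 0 help out.\<close>
  proof (cases "3 * s + q = 0")
    case True
    then have "q = - (3 * s)" by (simp add: eq_neg_iff_add_eq_0 add.commute)
    then show ?thesis using c_odd[OF s3(1)] c3s by simp
  next
    case False
    then show ?thesis using c[OF sO that, of n] by (simp add: d'0 cs)
  qed
  show ?thesis
  proof (intro exI[of _ d] conjI ballI allI)
    show "B \<alpha> i j = d (i + j) * \<alpha>" if "\<alpha> \<in> \<Gamma>" for \<alpha> i j
      using B1[OF that] d that d'0 by simp
    show "C p i j = 2 * d (i + j) * p" if "p \<in> \<Omega>" for p i j
      using C1[OF that] c0[OF that, of "i + j"] by (simp add: c_def)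
  qed
qed

end

subsection \<open>The bracket and the cocycles of Virasoro type\<close>

text \<open>Reading the bracket coordinatewise lets it inherit bilinearity from
  \<open>bilinear_extend\<close>.\<close>

lemma lookup_sv_bracket:
  "Poly_Mapping.lookup (sv_bracket x y) r =
    bilinear_extend (\<lambda>p q. Poly_Mapping.lookup (sv_bracket_basis p q) r) x y"
  by (simp add: sv_bracket_def bilinear_extend_def lookup_sum)

lemma sv_bracket_single [simp]:
  "sv_bracket (Poly_Mapping.single p a) (Poly_Mapping.single q b) = vscale (a * b) (sv_bracket_basis p q)"
  by (rule poly_mapping_eqI) (simp add: lookup_sv_bracket)

lemma sv_bracket_linear:
  "sv_bracket (x + x') y = sv_bracket x y + sv_bracket x' y"
  "sv_bracket x (y + y') = sv_bracket x y + sv_bracket x y'"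
  "sv_bracket (vscale c x) y = vscale c (sv_bracket x y)"
  "sv_bracket x (vscale c y) = vscale c (sv_bracket x y)"
  by (rule poly_mapping_eqI,
      simp add: lookup_sv_bracket lookup_add
        linear_form_onD[OF linear_form_on_bilinear_extend_left[of UNIV]]
        linear_form_onD[OF linear_form_on_bilinear_extend_right[of UNIV]])+

lemma sv_carrier_eq: "sv_carrier \<Gamma> s = fin_span (sv_basis \<Gamma> s)"
  by (simp add: sv_carrier_def fin_span_def)

lemma Lb_in_sv_basis [simp]: "Lb \<alpha> i \<in> sv_basis \<Gamma> s \<longleftrightarrow> \<alpha> \<in> \<Gamma>"
  and Mb_in_sv_basis [simp]: "Mb \<alpha> i \<in> sv_basis \<Gamma> s \<longleftrightarrow> \<alpha> \<in> \<Gamma>"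
  and Yb_in_sv_basis [simp]: "Yb p i \<in> sv_basis \<Gamma> s \<longleftrightarrow> p - s \<in> \<Gamma>"
  by (auto simp: sv_basis_def) (metis diff_add_cancel)

text \<open>On a basis pair only k = i + j contributes to the sum over k, so the infinite family
  collapses to one coefficient evaluated at the total degree.\<close>

fun virasoro_basis :: "(int \<Rightarrow> 'f) \<Rightarrow> 'f sv_index \<Rightarrow> 'f sv_index \<Rightarrow> 'f::field" where
  "virasoro_basis c (Lb a i) (Lb b j) = (if a + b = 0 then c (i + j) * ((a ^ 3 - a) / 12) else 0)"
| "virasoro_basis c _ _ = 0"

lemma phi_sum_eq:
  "phi_sum \<Gamma> s c x y = (if x \<in> sv_carrier \<Gamma> s \<and> y \<in> sv_carrier \<Gamma> s
     then bilinear_extend (virasoro_basis c) x y else 0)"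
proof (cases "x \<in> sv_carrier \<Gamma> s \<and> y \<in> sv_carrier \<Gamma> s")
  case True
  define deg :: "'a sv_index \<Rightarrow> int" where
    "deg p = (case p of Lb a i \<Rightarrow> i | Mb a i \<Rightarrow> i | Yb a i \<Rightarrow> i)" for p
  \<comment> \<open>The total degrees occurring in the two supports: a finite set outside which
    every term of the sum over k vanishes.\<close>
  define K where "K = (\<lambda>(p, q). deg p + deg q) ` (Poly_Mapping.keys x \<times> Poly_Mapping.keys y)"
  have [simp]: "finite K" by (simp add: K_def)
  have deg: "phi_basis k p q = 0" if "k \<noteq> deg p + deg q" for k and p q :: "'a sv_index"
    using that by (cases p; cases q) (auto simp: deg_def)
  have *: "(\<Sum>k\<in>K. c k * phi_basis k p q) = virasoro_basis c p q"
    if "p \<in> Poly_Mapping.keys x" "q \<in> Poly_Mapping.keys y" for p q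
  proof -
    have "deg p + deg q \<in> K" using that by (force simp: K_def)
    then have "(\<Sum>k\<in>K. c k * phi_basis k p q) = c (deg p + deg q) * phi_basis (deg p + deg q) p q"
      using deg by (subst sum.mono_neutral_right[where S = "{deg p + deg q}"]) auto
    also have "\<dots> = virasoro_basis c p q"
      by (cases p; cases q) (auto simp: deg_def)
    finally show ?thesis .
  qed
  have phi: "phi \<Gamma> s k x y = bilinear_extend (phi_basis k) x y" for k
    using True by (simp add: phi_def bilinear_extend_def)
  have "bilinear_extend (phi_basis k) x y = 0" if "k \<notin> K" for k
    unfolding bilinear_extend_def using that deg[of k]
    by (intro sum.neutral ballI) (force simp: K_def)
  then have "phi_sum \<Gamma> s c x y = (\<Sum>k\<in>K. c k * bilinear_extend (phi_basis k) x y)"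
    unfolding phi_sum_def phi by (subst Sum_any.expand_superset[of K]) auto
  also have "\<dots> = bilinear_extend (\<lambda>p q. \<Sum>k\<in>K. c k * phi_basis k p q) x y"
    unfolding bilinear_extend_def sum_distrib_left
    by (subst sum.swap, rule sum.cong[OF refl], subst sum.swap) (simp add: mult_ac)
  also have "\<dots> = bilinear_extend (virasoro_basis c) x y"
    unfolding bilinear_extend_def by (intro sum.cong refl) (simp add: *)
  finally show ?thesis using True by simp
next
  case False
  then have "phi \<Gamma> s k x y = 0" for k by (auto simp: phi_def)
  with False show ?thesis by (auto simp: phi_sum_def)
qed

text \<open>Lets every fact about a single \<open>phi\<close> be read off from
  \<open>phi_sum\<close>.\<close>

lemma phi_eq_phi_sum: "phi \<Gamma> s k = phi_sum \<Gamma> s (\<lambda>n. if n = k then 1 else 0)"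
proof (intro ext)
  fix x y
  have "phi_basis k = virasoro_basis (\<lambda>n. if n = k then 1 else 0 :: 'a)"
    by (intro ext, rename_tac p q, case_tac p; case_tac q) auto
  then show "phi \<Gamma> s k x y = phi_sum \<Gamma> s (\<lambda>n. if n = k then 1 else 0) x y"
    unfolding phi_sum_eq phi_def bilinear_extend_def by simp
qed

lemma virasoro_basis_add: "virasoro_basis (\<lambda>k. c k + d k) p q = virasoro_basis c p q + virasoro_basis d p q"
  by (cases p; cases q) (auto simp: distrib_right)

lemma virasoro_basis_scale: "virasoro_basis (\<lambda>k. a * c k) p q = a * virasoro_basis c p q"
  by (cases p; cases q) auto

lemma phi_sum_add: "phi_sum \<Gamma> s (\<lambda>k. c k + d k) = (\<lambda>x y. phi_sum \<Gamma> s c x y + phi_sum \<Gamma> s d x y)"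
  by (intro ext) (simp add: phi_sum_eq bilinear_extend_def virasoro_basis_add sum.distrib distrib_left)

lemma phi_sum_scale: "phi_sum \<Gamma> s (\<lambda>k. a * c k) = (\<lambda>x y. a * phi_sum \<Gamma> s c x y)"
  by (intro ext) (simp add: phi_sum_eq bilinear_extend_def virasoro_basis_scale sum_distrib_left mult_ac)

lemma phi_sum_single:
  assumes "p \<in> sv_basis \<Gamma> s" "q \<in> sv_basis \<Gamma> s"
  shows "phi_sum \<Gamma> s c (Poly_Mapping.single p a) (Poly_Mapping.single q b) = a * b * virasoro_basis c p q"
  using assms by (simp add: phi_sum_eq sv_carrier_eq)

lemma bilinear_form_on_phi_sum: "bilinear_form_on (sv_carrier \<Gamma> s) (phi_sum \<Gamma> s c)"
  unfolding sv_carrier_eq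
  by (rule bilinear_form_on_restrict[where g = "bilinear_extend (virasoro_basis c)"])
    (auto simp: phi_sum_eq sv_carrier_eq linear_form_on_bilinear_extend_left linear_form_on_bilinear_extend_right)

section \<open>Closure of the carrier, coboundaries and Virasoro cocycles\<close>

locale schroedinger_virasoro =
  fixes \<Gamma> :: "'f::field_char_0 set" and s :: 'f
  assumes zero_in: "0 \<in> \<Gamma>"
    and add_in: "\<And>\<alpha> \<beta>. \<alpha> \<in> \<Gamma> \<Longrightarrow> \<beta> \<in> \<Gamma> \<Longrightarrow> \<alpha> + \<beta> \<in> \<Gamma>"
    and uminus_in: "\<And>\<alpha>. \<alpha> \<in> \<Gamma> \<Longrightarrow> - \<alpha> \<in> \<Gamma>"
    and s_notin: "s \<notin> \<Gamma>" and double_s_in: "2 * s \<in> \<Gamma>"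
begin

lemma s_nonzero [simp]: "s \<noteq> 0"
  using s_notin zero_in by auto

text \<open>The nonzero element 2s of \<Gamma> is the step size in all functional equations; s is
  nonzero because 0 lies in \<Gamma> and s does not.\<close>

sublocale nontrivial_additive_subgroup \<Gamma> "2 * s"
  by unfold_locales (simp_all add: zero_in add_in uminus_in double_s_in)

abbreviation "S \<equiv> sv_basis \<Gamma> s"
abbreviation "W \<equiv> sv_carrier \<Gamma> s"
abbreviation e :: "'f sv_index \<Rightarrow> 'f sv_index \<Rightarrow>\<^sub>0 'f" where "e p \<equiv> Poly_Mapping.single p 1"

text \<open>For two \<open>Y\<close> weights, p + q = (p - s) + (q - s) + 2s, which is where 2s in
  \<Gamma> enters.\<close>

lemma coset_add:
  "p - s \<in> \<Gamma> \<Longrightarrow> q - s \<in> \<Gamma> \<Longrightarrow> p + q \<in> \<Gamma>"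
  "\<alpha> \<in> \<Gamma> \<Longrightarrow> p - s \<in> \<Gamma> \<Longrightarrow> \<alpha> + p - s \<in> \<Gamma>"
  "\<alpha> \<in> \<Gamma> \<Longrightarrow> p - s \<in> \<Gamma> \<Longrightarrow> p + \<alpha> - s \<in> \<Gamma>"
  using add_in[of "p - s + (q - s)" "2 * s"] add_in[of "p - s" "q - s"] add_in[of \<alpha> "p - s"] double_s_in
  by (simp_all add: algebra_simps)

lemma sv_bracket_basis_in: "p \<in> S \<Longrightarrow> q \<in> S \<Longrightarrow> sv_bracket_basis p q \<in> fin_span S"
  by (cases p; cases q) (auto intro!: single_in_fin_span simp: coset_add)

lemma sv_bracket_in: "x \<in> W \<Longrightarrow> y \<in> W \<Longrightarrow> sv_bracket x y \<in> W"
  unfolding sv_bracket_def sv_carrier_eq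
  by (intro sum_in_fin_span vscale_in_fin_span sv_bracket_basis_in) (auto simp: fin_span_def)

lemma single_in: "p \<in> S \<Longrightarrow> Poly_Mapping.single p a \<in> W"
  by (simp add: sv_carrier_eq)

text \<open>The Jacobi sum \<open>J\<close> is linear in its first argument and cyclically
  invariant, so basis vectors are replaced by arbitrary vectors one slot at a time.\<close>

lemma cocycles2I:
  assumes \<psi>: "bilinear_form_on W \<psi>"
    and anti: "\<And>p q. p \<in> S \<Longrightarrow> q \<in> S \<Longrightarrow> \<psi> (e p) (e q) = - \<psi> (e q) (e p)"
    and jac: "\<And>p q r. p \<in> S \<Longrightarrow> q \<in> S \<Longrightarrow> r \<in> S \<Longrightarrow>
      \<psi> (e p) (sv_bracket_basis q r) + \<psi> (e q) (sv_bracket_basis r p) + \<psi> (e r) (sv_bracket_basis p q) = 0"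
  shows "\<psi> \<in> cocycles2 W sv_bracket"
proof -
  have anti': "\<psi> = (\<lambda>x y. - 1 * \<psi> y x)"
  proof (rule bilinear_form_on_eqI[of S])
    show "bilinear_form_on (fin_span S) (\<lambda>x y. - 1 * \<psi> y x)"
      using \<psi> unfolding sv_carrier_eq bilinear_form_on_def
      by (intro conjI ballI linear_form_on_scale) auto
    show "\<psi> (e p) (e q) = - 1 * \<psi> (e q) (e p)" if "p \<in> S" "q \<in> S" for p q
      using anti[OF that] by simp
  qed (use \<psi> in \<open>simp add: sv_carrier_eq\<close>)
  define J where "J x y z = \<psi> x (sv_bracket y z) + \<psi> y (sv_bracket z x) + \<psi> z (sv_bracket x y)" for x y z
  have rot: "J x y z = J y z x" for x y z
    by (simp add: J_def)
  have lin: "linear_form_on (fin_span S) (\<lambda>x. J x y z)" if "y \<in> W" "z \<in> W" for y z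
    using \<psi> that sv_bracket_in unfolding J_def
    by (auto simp: bilinear_form_on_def linear_form_on_def sv_bracket_linear algebra_simps
      simp flip: sv_carrier_eq)
  have J0: "J x y z = 0" if "\<And>p. p \<in> S \<Longrightarrow> J (e p) y z = 0" "x \<in> W" "y \<in> W" "z \<in> W" for x y z
    by (rule linear_form_on_eqI[OF lin linear_form_on_const_zero])
      (use that in \<open>simp_all add: sv_carrier_eq\<close>)
  have 1: "J (e p) (e q) (e r) = 0" if "p \<in> S" "q \<in> S" "r \<in> S" for p q r
    using jac[OF that] by (simp add: J_def)
  have 2: "J z (e p) (e q) = 0" if "p \<in> S" "q \<in> S" "z \<in> W" for p q z
    by (rule J0) (use that 1 single_in in auto)
  have 3: "J y z (e p) = 0" if "p \<in> S" "y \<in> W" "z \<in> W" for p y z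
    by (rule J0) (use that 2 rot[of _ z "e p"] single_in in auto)
  have "J x y z = 0" if "x \<in> W" "y \<in> W" "z \<in> W" for x y z
    by (rule J0) (use that 3 rot[of _ y z] in auto)
  moreover have "\<psi> x y = - \<psi> y x" for x y
    by (subst anti') simp
  ultimately show ?thesis
    using \<psi> unfolding cocycles2_def J_def by blast
qed

lemma coboundary2_single:
  assumes f: "linear_form_on W f" and "p \<in> S" "q \<in> S"
  shows "coboundary2 W sv_bracket f (Poly_Mapping.single p a) (Poly_Mapping.single q b) =
    a * b * f (sv_bracket_basis p q)"
  using assms linear_form_onD(2)[OF f, of "sv_bracket_basis p q"] sv_bracket_basis_in
  by (simp add: coboundary2_def sv_carrier_eq)

lemma bilinear_form_on_coboundary2:
  assumes f: "linear_form_on W f"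
  shows "bilinear_form_on W (coboundary2 W sv_bracket f)"
  unfolding sv_carrier_eq
  by (rule bilinear_form_on_restrict[where g = "\<lambda>x y. f (sv_bracket x y)"])
    (use f sv_bracket_in in \<open>auto simp: coboundary2_def linear_form_on_def sv_bracket_linear
       simp flip: sv_carrier_eq\<close>)

text \<open>On basis elements the condition is \<open>f\<close> applied to the Jacobi identity of
  the algebra, checked in all 27 combinations of \<open>L\<close>, \<open>M\<close>,
  \<open>Y\<close>.\<close>

lemma coboundary2_cocycle:
  assumes f: "linear_form_on W f"
  shows "coboundary2 W sv_bracket f \<in> cocycles2 W sv_bracket"
proof (rule cocycles2I[OF bilinear_form_on_coboundary2[OF f]])
  define F where "F t = f (e t)" for t
  have F: "f (Poly_Mapping.single t a) = a * F t" if "t \<in> S" for t a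
    using linear_form_onD(2)[OF f single_in[OF that], of a 1] by (simp add: F_def)
  have F0: "f 0 = 0"
    using linear_form_on_zero f unfolding sv_carrier_eq by blast
  have c0: "coboundary2 W sv_bracket f (Poly_Mapping.single p a) 0 = 0" for p a
    using F0 by (simp add: coboundary2_def sv_bracket_def)
  fix p q assume pq: "p \<in> S" "q \<in> S"
  then show "coboundary2 W sv_bracket f (e p) (e q) = - coboundary2 W sv_bracket f (e q) (e p)"
    unfolding coboundary2_single[OF f pq] coboundary2_single[OF f pq(2,1)]
    by (cases p; cases q) (simp_all add: F F0 coset_add algebra_simps)
  fix r assume r: "r \<in> S"
  note [simp] = c0 coboundary2_single[OF f] F F0 coset_add add_in
  show "coboundary2 W sv_bracket f (e p) (sv_bracket_basis q r) +
    coboundary2 W sv_bracket f (e q) (sv_bracket_basis r p) +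
    coboundary2 W sv_bracket f (e r) (sv_bracket_basis p q) = 0"
    using pq r by (cases p; cases q; cases r) (simp_all, simp_all add: field_simps)
qed

lemma coboundaries2_subset: "coboundaries2 W sv_bracket \<subseteq> cocycles2 W sv_bracket"
  using coboundary2_cocycle by (auto simp: coboundaries2_def)

lemma phi_sum_cocycle: "phi_sum \<Gamma> s c \<in> cocycles2 W sv_bracket"
proof (rule cocycles2I[OF bilinear_form_on_phi_sum])
  have c0: "phi_sum \<Gamma> s c x 0 = 0" for x
    by (simp add: phi_sum_eq bilinear_extend_def)
  fix p q assume pq: "p \<in> S" "q \<in> S"
  show "phi_sum \<Gamma> s c (e p) (e q) = - phi_sum \<Gamma> s c (e q) (e p)"
  proof -
    have "C * ((\<alpha> ^ 3 - \<alpha>) / 12) = - (C * ((\<beta> ^ 3 - \<beta>) / 12))" if "\<alpha> + \<beta> = 0" for \<alpha> \<beta> C :: 'f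
    proof -
      have "\<alpha> = - \<beta>" using that by (simp add: eq_neg_iff_add_eq_0)
      then show ?thesis by (simp add: field_simps)
    qed
    then show ?thesis
      using pq by (cases p; cases q) (simp_all add: phi_sum_single add.commute)
  qed
  fix r assume r: "r \<in> S"
  \<comment> \<open>The linear parts cancel identically; the cubic parts sum, up to sign, to
    (\<alpha> - \<beta>)(\<beta> - \<gamma>)(\<gamma> - \<alpha>)(\<alpha> + \<beta> + \<gamma>)
    times C/12. All three terms share C because they have the same total degree.\<close>
  have *: "(\<gamma> - \<beta>) * (C * ((\<alpha> ^ 3 - \<alpha>) / 12)) + (\<alpha> - \<gamma>) * (C * ((\<beta> ^ 3 - \<beta>) / 12))
     + (\<beta> - \<alpha>) * (C * ((\<gamma> ^ 3 - \<gamma>) / 12)) = 0" if "\<alpha> + (\<beta> + \<gamma>) = 0" for \<alpha> \<beta> \<gamma> C :: 'f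
  proof -
    have \<alpha>: "\<alpha> = - (\<beta> + \<gamma>)" using that by (simp only: eq_neg_iff_add_eq_0)
    show ?thesis unfolding \<alpha> by (simp add: field_simps power3_eq_cube)
  qed
  show "phi_sum \<Gamma> s c (e p) (sv_bracket_basis q r) + phi_sum \<Gamma> s c (e q) (sv_bracket_basis r p) +
    phi_sum \<Gamma> s c (e r) (sv_bracket_basis p q) = 0"
    using pq r * by (cases p; cases q; cases r)
      (simp_all add: c0 phi_sum_single coset_add add_in add.commute add.left_commute)
qed

end

subsection \<open>Decomposition of cocycles\<close>

text \<open>The eigenvalue under bracketing with \<open>Lb 0 0\<close>; for \<open>Yb\<close> the
  shift by s is already contained in the label.\<close>

fun weight :: "'f sv_index \<Rightarrow> 'f" where
  "weight (Lb a i) = a"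
| "weight (Mb a i) = a"
| "weight (Yb a i) = a"

text \<open>
  A separate constant for the values on basis pairs: reducing \<open>\<psi> (single p a) (single q b)\<close> to
  \<open>a * b * \<psi> (single p 1) (single q 1)\<close> is not a terminating rewrite rule.
\<close>

definition basis_value :: "('b, 'f::field) form \<Rightarrow> 'b \<Rightarrow> 'b \<Rightarrow> 'f" where
  "basis_value \<psi> p q = \<psi> (Poly_Mapping.single p 1) (Poly_Mapping.single q 1)"

context schroedinger_virasoro
begin

section \<open>Values of a fixed cocycle on basis pairs\<close>

context
  fixes \<psi> :: "('f sv_index, 'f) form"
  assumes \<psi>: "\<psi> \<in> cocycles2 W sv_bracket"
begin

abbreviation "g \<equiv> basis_value \<psi>"

lemma cocycle_bilinear: "bilinear_form_on W \<psi>"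
  using \<psi> by (simp add: cocycles2_def)

lemma cocycle_single:
  assumes "p \<in> S" "q \<in> S"
  shows "\<psi> (Poly_Mapping.single p a) (Poly_Mapping.single q b) = a * b * g p q"
proof -
  have "\<psi> (vscale a (e p)) (vscale b (e q)) = a * (b * \<psi> (e p) (e q))"
    using assms linear_form_onD(2)[OF bilinear_form_onD(1)[OF cocycle_bilinear]]
      linear_form_onD(2)[OF bilinear_form_onD(2)[OF cocycle_bilinear]] single_in
    by (metis vscale_single)
  then show ?thesis by (simp add: basis_value_def)
qed

lemma cocycle_zero_right: "p \<in> S \<Longrightarrow> \<psi> (Poly_Mapping.single p a) 0 = 0"
  using linear_form_on_zero[OF bilinear_form_onD(2)[OF cocycle_bilinear, unfolded sv_carrier_eq]]
  by (simp add: sv_carrier_eq)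

lemma cocycle_anti: "p \<in> S \<Longrightarrow> q \<in> S \<Longrightarrow> g p q = - g q p"
  using \<psi> single_in unfolding cocycles2_def basis_value_def by blast

lemma cocycle_jacobi:
  assumes "p \<in> S" "q \<in> S" "r \<in> S"
  shows "\<psi> (e p) (sv_bracket_basis q r) + \<psi> (e q) (sv_bracket_basis r p) + \<psi> (e r) (sv_bracket_basis p q) = 0"
proof -
  have "\<psi> (e p) (sv_bracket (e q) (e r)) + \<psi> (e q) (sv_bracket (e r) (e p)) + \<psi> (e r) (sv_bracket (e p) (e q)) = 0"
    using \<psi> single_in assms unfolding cocycles2_def by blast
  then show ?thesis by (simp)
qed

text \<open>Off total weight zero the cocycle is thereby determined by its values against
  \<open>Lb 0 0\<close>, from which the primitive \<open>f0\<close> is built below.\<close>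

lemma cocycle_weight:
  assumes pq: "p \<in> S" "q \<in> S"
  shows "(weight p + weight q) * g p q = \<psi> (e (Lb 0 0)) (sv_bracket_basis p q)"
proof -
  have bra: "sv_bracket_basis p (Lb 0 0) = Poly_Mapping.single p (- weight p)" for p :: "'f sv_index"
    by (cases p) auto
  have bra': "sv_bracket_basis (Lb 0 0) p = Poly_Mapping.single p (weight p)" for p :: "'f sv_index"
    by (cases p) auto
  have "\<psi> (e p) (sv_bracket_basis q (Lb 0 0)) + \<psi> (e q) (sv_bracket_basis (Lb 0 0) p)
      + \<psi> (e (Lb 0 0)) (sv_bracket_basis p q) = 0"
    using cocycle_jacobi[OF pq, of "Lb 0 0"] by simp
  then have "- (weight q * g p q) + weight p * g q p
      + \<psi> (e (Lb 0 0)) (sv_bracket_basis p q) = 0"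
    using pq unfolding bra bra' by (simp add: cocycle_single)
  then show ?thesis
    using cocycle_anti[OF pq] by algebra
qed

lemma cocycle_LL:
  "\<exists>c d. \<forall>\<alpha>\<in>\<Gamma>. \<forall>i j. g (Lb \<alpha> i) (Lb (- \<alpha>) j) = c (i + j) * \<alpha> ^ 3 + d (i + j) * \<alpha>"
proof (rule LL_pairing_form)
  show "g (Lb \<alpha> i) (Lb (- \<alpha>) j) = - g (Lb (- \<alpha>) j) (Lb (- (- \<alpha>)) i)"
    if "\<alpha> \<in> \<Gamma>" for \<alpha> i j
    using cocycle_anti[of "Lb \<alpha> i" "Lb (- \<alpha>) j"] that by simp
  fix \<alpha> \<beta> \<gamma> :: 'f and i j k :: int
  assume in_\<Gamma>: "\<alpha> \<in> \<Gamma>" "\<beta> \<in> \<Gamma>" "\<gamma> \<in> \<Gamma>" and sum: "\<alpha> + \<beta> + \<gamma> = 0"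
  have "\<beta> + \<gamma> = - \<alpha>" "\<gamma> + \<alpha> = - \<beta>" "\<alpha> + \<beta> = - \<gamma>"
    using sum by (simp_all add: eq_neg_iff_add_eq_0 add_ac)
  then show "(\<gamma> - \<beta>) * g (Lb \<alpha> i) (Lb (- \<alpha>) (j + k)) +
    (\<alpha> - \<gamma>) * g (Lb \<beta> j) (Lb (- \<beta>) (k + i)) +
    (\<beta> - \<alpha>) * g (Lb \<gamma> k) (Lb (- \<gamma>) (i + j)) = 0"
    using cocycle_jacobi[of "Lb \<alpha> i" "Lb \<beta> j" "Lb \<gamma> k"] in_\<Gamma> by (simp add: cocycle_single)
qed

text \<open>Brackets of two \<open>Y\<close> produce \<open>M\<close> while \<open>M\<close>
  commutes with \<open>Y\<close>, so the Jacobi identity for \<open>M\<close>, \<open>Y\<close>,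
  \<open>Y\<close> retains a single term.\<close>

lemma cocycle_MM:
  assumes \<alpha>: "\<alpha> \<in> \<Gamma>"
  shows "g (Mb \<alpha> i) (Mb (- \<alpha>) j) = 0"
proof -
  have *: "(- \<alpha> - 2 * p) * g (Mb \<alpha> i) (Mb (- \<alpha>) j) = 0" if p: "p - s \<in> \<Gamma>" for p
  proof -
    have "- \<alpha> + - (p - s) + - (2 * s) \<in> \<Gamma>"
      using \<alpha> p by (intro add uminus) auto
    then have "- \<alpha> - p - s \<in> \<Gamma>" by (simp add: algebra_simps)
    then have "(- \<alpha> - p - p) * g (Mb \<alpha> i) (Mb (- \<alpha>) j) = 0"
      using cocycle_jacobi[of "Mb \<alpha> i" "Yb p 0" "Yb (- \<alpha> - p) j"] p \<alpha>
      by (simp add: cocycle_single cocycle_zero_right del: mult_eq_0_iff)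
    then show ?thesis by algebra
  qed
  \<comment> \<open>One weight p might make the factor -\<alpha> - 2p vanish; for p = s and p = 3s
    the two factors differ by 4s.\<close>
  have "3 * s - s \<in> \<Gamma>" using double_s_in by (simp add: algebra_simps)
  from *[OF this] *[of s] have "(4 * s) * g (Mb \<alpha> i) (Mb (- \<alpha>) j) = 0"
    by (simp add: algebra_simps)
  then show ?thesis by simp
qed

lemma cocycle_LM_YY:
  "\<exists>d. (\<forall>\<alpha>\<in>\<Gamma>. \<forall>i j. g (Lb \<alpha> i) (Mb (- \<alpha>) j) = d (i + j) * \<alpha>) \<and>
    (\<forall>p\<in>{p. p - s \<in> \<Gamma>}. \<forall>i j. g (Yb p i) (Yb (- p) j) = 2 * d (i + j) * p)"
proof (rule LM_YY_pairing_form[of s])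
  have pm: "- p - s \<in> \<Gamma>" if "p - s \<in> \<Gamma>" for p
    using add[OF uminus[OF that] uminus[OF double_s_in]] by (simp add: algebra_simps)
  show "0 \<notin> {p. p - s \<in> \<Gamma>}"
    using uminus[of "0 - s"] s_notin by auto
  show "g (Yb p i) (Yb (- p) j) = - g (Yb (- p) j) (Yb (- (- p)) i)"
    if "p \<in> {p. p - s \<in> \<Gamma>}" for p i j
    using cocycle_anti[of "Yb p i" "Yb (- p) j"] that pm by simp
  show "(\<alpha> + \<beta>) * (g (Lb \<alpha> i) (Mb (- \<alpha>) (j + k)) - g (Lb \<beta> j) (Mb (- \<beta>) (i + k))) +
    (\<beta> - \<alpha>) * g (Lb (\<alpha> + \<beta>) (i + j)) (Mb (- (\<alpha> + \<beta>)) k) = 0"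
    if in_\<Gamma>: "\<alpha> \<in> \<Gamma>" "\<beta> \<in> \<Gamma>" for \<alpha> \<beta> i j k
  proof -
    \<comment> \<open>The weight of \<open>M\<close> that brings the triple to total weight zero,
      kept as an atom during simplification.\<close>
    define \<gamma> where "\<gamma> = - (\<alpha> + \<beta>)"
    have "\<gamma> \<in> \<Gamma>" using in_\<Gamma> add uminus unfolding \<gamma>_def by blast
    have eqs: "\<beta> + \<gamma> = - \<alpha>" "\<alpha> + \<gamma> = - \<beta>" by (simp_all add: \<gamma>_def)
    have "\<gamma> * g (Lb \<alpha> i) (Mb (- \<alpha>) (j + k)) - \<gamma> * g (Lb \<beta> j) (Mb (- \<beta>) (i + k))
      + (\<beta> - \<alpha>) * g (Mb \<gamma> k) (Lb (\<alpha> + \<beta>) (i + j)) = 0"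
      using cocycle_jacobi[of "Lb \<alpha> i" "Lb \<beta> j" "Mb \<gamma> k"] in_\<Gamma> \<open>\<gamma> \<in> \<Gamma>\<close>
      by (simp add: cocycle_single eqs add.commute)
    moreover have "g (Mb \<gamma> k) (Lb (\<alpha> + \<beta>) (i + j)) = - g (Lb (\<alpha> + \<beta>) (i + j)) (Mb \<gamma> k)"
      using in_\<Gamma> \<open>\<gamma> \<in> \<Gamma>\<close> by (intro cocycle_anti) auto
    ultimately show ?thesis unfolding \<gamma>_def by algebra
  qed
  show "(q - p) * g (Lb \<alpha> i) (Mb (- \<alpha>) (j + k)) -
    (q - \<alpha> / 2) * g (Yb p j) (Yb (- p) (k + i)) +
    (p - \<alpha> / 2) * g (Yb q k) (Yb (- q) (i + j)) = 0"
    if "\<alpha> \<in> \<Gamma>" "p \<in> {p. p - s \<in> \<Gamma>}" "q \<in> {p. p - s \<in> \<Gamma>}" "\<alpha> + p + q = 0" for \<alpha> p q i j k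
  proof -
    have eqs: "p + q = - \<alpha>" "q + \<alpha> = - p" "\<alpha> + p = - q"
      using that(4) by (simp_all add: eq_neg_iff_add_eq_0 add_ac)
    have "\<psi> (e (Lb \<alpha> i)) (Poly_Mapping.single (Mb (- \<alpha>) (j + k)) (q - p)) +
      \<psi> (e (Yb p j)) (Poly_Mapping.single (Yb (- p) (k + i)) (- (q - \<alpha> / 2))) +
      \<psi> (e (Yb q k)) (Poly_Mapping.single (Yb (- q) (i + j)) (p - \<alpha> / 2)) = 0"
      using cocycle_jacobi[of "Lb \<alpha> i" "Yb p j" "Yb q k"] that(1-3) by (simp add: eqs)
    then show ?thesis
      using that(1-3) pm[of p] pm[of q] by (simp only: cocycle_single[of "Lb \<alpha> i" "Mb (- \<alpha>) (j + k)"]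
        cocycle_single[of "Yb p j"] cocycle_single[of "Yb q k"] Lb_in_sv_basis Mb_in_sv_basis
        Yb_in_sv_basis uminus mem_Collect_eq) (simp add: algebra_simps)
  qed
qed auto

lemma cocycle_decomposition:
  "\<exists>c f. linear_form_on W f \<and> \<psi> = (\<lambda>x y. phi_sum \<Gamma> s c x y + coboundary2 W sv_bracket f x y)"
proof -
  obtain c d where LL: "\<And>\<alpha> i j. \<alpha> \<in> \<Gamma> \<Longrightarrow>
      g (Lb \<alpha> i) (Lb (- \<alpha>) j) = c (i + j) * \<alpha> ^ 3 + d (i + j) * \<alpha>"
    using cocycle_LL by blast
  obtain d' where LM: "\<And>\<alpha> i j. \<alpha> \<in> \<Gamma> \<Longrightarrow> g (Lb \<alpha> i) (Mb (- \<alpha>) j) = d' (i + j) * \<alpha>"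
    and YY: "\<And>p i j. p - s \<in> \<Gamma> \<Longrightarrow> g (Yb p i) (Yb (- p) j) = 2 * d' (i + j) * p"
    using cocycle_LM_YY by blast
  \<comment> \<open>At weight zero the values are forced: -2\<alpha> f(L_0) must supply (c +
    d)\<alpha>, the part left after removing c(\<alpha>^3 - \<alpha>), and -\<alpha> f(M_0) must
    supply d'\<alpha>. The value -d' also fits the \<open>Y\<close> pairs, as -2p f(M_0) = 2 d' p.
    The \<open>Yb\<close> default is never reached on the carrier.\<close>
  define f0 where "f0 t = (if weight t \<noteq> 0 then g (Lb 0 0) t / weight t else
    (case t of Lb _ n \<Rightarrow> - (c n + d n) / 2 | Mb _ n \<Rightarrow> - d' n | Yb _ _ \<Rightarrow> 0))" for t
  let ?f = "linear_extend f0" and ?c = "\<lambda>n. 12 * c n"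
  have f: "linear_form_on W ?f" by (rule linear_form_on_linear_extend)
  have f_zero: "?f 0 = 0" by (simp add: linear_extend_def)
  have "g p q = virasoro_basis ?c p q + ?f (sv_bracket_basis p q)" if pq: "p \<in> S" "q \<in> S" for p q
  proof (cases "weight p + weight q = 0")
    case False
    have "virasoro_basis ?c p q = 0"
      using False by (cases p; cases q) auto
    moreover have "(weight p + weight q) * ?f (sv_bracket_basis p q) = \<psi> (e (Lb 0 0)) (sv_bracket_basis p q)"
      using False pq f_zero by (cases p; cases q)
        (simp_all add: f0_def cocycle_single cocycle_zero_right coset_add)
    ultimately show ?thesis
      using cocycle_weight[OF pq] False by (metis add_0 mult_left_cancel)
  next
    case True
    then have wq: "weight q = - weight p" by (simp add: eq_neg_iff_add_eq_0 add.commute)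
    \<comment> \<open>A \<open>Y\<close> weight opposite to an element of \<Gamma> would put -s,
      hence s, into \<Gamma>.\<close>
    have no_LY: False if "\<alpha> \<in> \<Gamma>" "p - s \<in> \<Gamma>" "p = - \<alpha>" for \<alpha> p
      using add[OF that(1,2)] that(3) s_notin uminus[of "- s"] by auto
    have no_LY': False if "\<alpha> \<in> \<Gamma>" "p - s \<in> \<Gamma>" "\<alpha> = - p" for \<alpha> p
      using no_LY[OF that(1,2)] that(3) by simp
    show ?thesis
    proof (cases p)
      case p: (Lb \<alpha> i)
      show ?thesis
        using pq wq no_LY[of \<alpha>] LL[of \<alpha> i] LM[of \<alpha> i] unfolding p
        by (cases q) (auto simp: f0_def field_simps)
    next
      case p: (Mb \<alpha> i)
      show ?thesis
      proof (cases q)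
        case q: (Lb \<beta> j)
        then have "\<alpha> = - \<beta>" using p wq by simp
        then show ?thesis
          using pq cocycle_anti[OF pq] LM[of \<beta> j i] unfolding p q by (simp add: f0_def add.commute)
      next
        case q: (Mb \<beta> j)
        then show ?thesis using pq wq cocycle_MM[of \<alpha> i j] by (simp add: p f_zero)
      next
        case q: (Yb \<beta> j)
        then show ?thesis using pq wq no_LY[of \<alpha> \<beta>] by (simp add: p)
      qed
    next
      case p: (Yb \<alpha> i)
      show ?thesis
        using pq wq no_LY' YY[of \<alpha> i] unfolding p
        by (cases q) (auto simp: f0_def algebra_simps)
    qed
  qed
  then have "\<psi> = (\<lambda>x y. phi_sum \<Gamma> s ?c x y + coboundary2 W sv_bracket ?f x y)"
    using cocycle_bilinear bilinear_form_on_add[OF bilinear_form_on_phi_sum bilinear_form_on_coboundary2[OF f]]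
    by (intro bilinear_form_on_eqI[of S])
      (simp_all add: basis_value_def phi_sum_single coboundary2_single[OF f] flip: sv_carrier_eq)
  with f show ?thesis by blast
qed

end

subsection \<open>The second cohomology group\<close>

text \<open>On \<open>Lb \<alpha> k\<close> and \<open>Lb (- \<alpha>) 0\<close> a coboundary is
  linear in \<alpha>, whereas \<open>phi_sum\<close> has cubic term c(k) \<alpha>^3 / 12.\<close>

lemma phi_sum_coboundary_iff: "phi_sum \<Gamma> s c \<in> coboundaries2 W sv_bracket \<longleftrightarrow> c = (\<lambda>k. 0)"
proof
  assume "phi_sum \<Gamma> s c \<in> coboundaries2 W sv_bracket"
  then obtain f where f: "linear_form_on W f" and eq: "phi_sum \<Gamma> s c = coboundary2 W sv_bracket f"
    by (auto simp: coboundaries2_def)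
  show "c = (\<lambda>k. 0)"
  proof
    fix k
    have *: "c k * (\<alpha> ^ 3 - \<alpha>) = - 24 * \<alpha> * f (e (Lb 0 k))" if "\<alpha> \<in> \<Gamma>" for \<alpha>
    proof -
      have "c k * ((\<alpha> ^ 3 - \<alpha>) / 12) = phi_sum \<Gamma> s c (e (Lb \<alpha> k)) (e (Lb (- \<alpha>) 0))"
        using that by (simp add: phi_sum_single)
      also have "\<dots> = f (vscale (- 2 * \<alpha>) (e (Lb 0 k)))"
        unfolding eq using that by (simp add: coboundary2_single[OF f])
      also have "\<dots> = - 2 * \<alpha> * f (e (Lb 0 k))"
        by (rule linear_form_onD(2)[OF f single_in]) simp
      finally show ?thesis by (simp add: field_simps)
    qed
    have "2 * (2 * s) \<in> \<Gamma>" by (rule double_e)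
    \<comment> \<open>Subtracting twice the equation at 2s from the one at 4s removes all linear
      terms: (64 - 16) s^3 c(k) = 0.\<close>
    from *[OF this] *[OF double_s_in] have "48 * s ^ 3 * c k = 0" by algebra
    then show "c k = 0" by simp
  qed
next
  assume "c = (\<lambda>k. 0)"
  then have "phi_sum \<Gamma> s c = (\<lambda>x y. 0)" using phi_sum_scale[of \<Gamma> s 0 "\<lambda>k. 0"] by simp
  then show "phi_sum \<Gamma> s c \<in> coboundaries2 W sv_bracket"
    using coboundaries2_zero by simp
qed

abbreviation "cls \<equiv> coh_class W sv_bracket"

lemma cls_phi_sum_eq_iff: "cls (phi_sum \<Gamma> s c) = cls (phi_sum \<Gamma> s d) \<longleftrightarrow> c = d"
proof -
  have "(\<lambda>x y. phi_sum \<Gamma> s c x y - phi_sum \<Gamma> s d x y) = phi_sum \<Gamma> s (\<lambda>k. c k + - 1 * d k)"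
    unfolding phi_sum_add phi_sum_scale by simp
  then show ?thesis
    by (simp add: coh_class_eq_iff phi_sum_cocycle phi_sum_coboundary_iff fun_eq_iff)
qed

lemma H2_eq_cls_phi_sum: "H2 W sv_bracket = range (\<lambda>c. cls (phi_sum \<Gamma> s c))"
proof (intro equalityI subsetI)
  fix A assume "A \<in> H2 W sv_bracket"
  then obtain \<psi> where \<psi>: "\<psi> \<in> cocycles2 W sv_bracket" "A = cls \<psi>"
    by (auto simp: H2_eq)
  then obtain c f where f: "linear_form_on W f"
    and eq: "\<psi> = (\<lambda>x y. phi_sum \<Gamma> s c x y + coboundary2 W sv_bracket f x y)"
    using cocycle_decomposition by blast
  have "cls \<psi> = cls (phi_sum \<Gamma> s c)"
    using \<psi>(1) phi_sum_cocycle linear_form_on_in_coboundaries2[OF f, of sv_bracket]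
    by (simp add: coh_class_eq_iff eq)
  then show "A \<in> range (\<lambda>c. cls (phi_sum \<Gamma> s c))" using \<psi> by blast
qed (auto simp: H2_eq phi_sum_cocycle)

lemma H2_add_cls_phi_sum:
  "H2_add (cls (phi_sum \<Gamma> s c)) (cls (phi_sum \<Gamma> s d)) = cls (phi_sum \<Gamma> s (\<lambda>k. c k + d k))"
  by (simp only: H2_add_coh_class phi_sum_cocycle phi_sum_add)

lemma H2_scale_cls_phi_sum:
  "H2_scale W sv_bracket a (cls (phi_sum \<Gamma> s c)) = cls (phi_sum \<Gamma> s (\<lambda>k. a * c k))"
  by (simp only: H2_scale_coh_class phi_sum_cocycle coboundaries2_subset phi_sum_scale)

lemma phi_not_coboundary: "cls (phi \<Gamma> s k) \<noteq> coboundaries2 W sv_bracket"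
proof
  assume "cls (phi \<Gamma> s k) = coboundaries2 W sv_bracket"
  then have "phi \<Gamma> s k \<in> coboundaries2 W sv_bracket"
    using coh_class_refl[OF phi_sum_cocycle] unfolding phi_eq_phi_sum by blast
  then show False
    unfolding phi_eq_phi_sum phi_sum_coboundary_iff by (metis zero_neq_one)
qed

section \<open>The direct product of the lines, parametrized by coefficient functions\<close>

definition product_element :: "(int \<Rightarrow> 'f) \<Rightarrow> int \<Rightarrow> ('f sv_index, 'f) form set" where
  "product_element c k = H2_scale W sv_bracket (c k) (cls (phi \<Gamma> s k))"

lemma product_element_eq: "product_element c k = cls (phi_sum \<Gamma> s (\<lambda>n. if n = k then c k else 0))"
proof -
  have "(\<lambda>n. c k * (if n = k then 1 else 0)) = (\<lambda>n. if n = k then c k else 0)" by auto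
  then show ?thesis
    by (simp add: product_element_def phi_eq_phi_sum H2_scale_cls_phi_sum)
qed

text \<open>No line is degenerate: distinct multiples of one class stay distinct by
  \<open>cls_phi_sum_eq_iff\<close>, so a product element recovers its coefficients.\<close>

lemma inj_product_element: "inj product_element"
proof (rule injI, rule ext)
  fix c d k assume "product_element c = product_element d"
  then have "product_element c k = product_element d k" by simp
  then have "(\<lambda>n. if n = k then c k else 0) = (\<lambda>n. if n = k then d k else 0)"
    unfolding product_element_eq cls_phi_sum_eq_iff .
  then show "c k = d k" by (metis (mono_tags))
qed

lemma product_element_add:
  "(\<lambda>k. H2_add (product_element c k) (product_element d k)) = product_element (\<lambda>k. c k + d k)"
proof
  fix k
  have "(\<lambda>n. (if n = k then c k else 0) + (if n = k then d k else 0)) = (\<lambda>n. if n = k then c k + d k else 0)"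
    by auto
  then show "H2_add (product_element c k) (product_element d k) = product_element (\<lambda>k. c k + d k) k"
    by (simp add: product_element_eq H2_add_cls_phi_sum)
qed

lemma product_element_scale:
  "(\<lambda>k. H2_scale W sv_bracket a (product_element c k)) = product_element (\<lambda>k. a * c k)"
proof
  fix k
  have "(\<lambda>n. a * (if n = k then c k else 0)) = (\<lambda>n. if n = k then a * c k else 0)" by auto
  then show "H2_scale W sv_bracket a (product_element c k) = product_element (\<lambda>k. a * c k) k"
    by (simp add: product_element_eq H2_scale_cls_phi_sum)
qed

lemma product_eq_range:
  "(\<Pi> k\<in>UNIV. H2_line W sv_bracket (cls (phi \<Gamma> s k))) = range product_element"
proof (intro equalityI subsetI)
  fix u assume "u \<in> (\<Pi> k\<in>UNIV. H2_line W sv_bracket (cls (phi \<Gamma> s k)))"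
  then have "\<forall>k. \<exists>c. u k = H2_scale W sv_bracket c (cls (phi \<Gamma> s k))"
    by (auto simp: H2_line_def)
  then obtain c where "u = product_element c"
    unfolding product_element_def by (metis ext)
  then show "u \<in> range product_element" by blast
qed (auto simp: H2_line_def product_element_def)

end

theorem theorem4p4:
  fixes \<Gamma> :: "'f::field_char_0 set" and s :: 'f
  assumes zero: "0 \<in> \<Gamma>"
    and add: "\<And>\<alpha> \<beta>. \<alpha> \<in> \<Gamma> \<Longrightarrow> \<beta> \<in> \<Gamma> \<Longrightarrow> \<alpha> + \<beta> \<in> \<Gamma>"
    and uminus: "\<And>\<alpha>. \<alpha> \<in> \<Gamma> \<Longrightarrow> - \<alpha> \<in> \<Gamma>"
    and proper: "\<Gamma> \<noteq> UNIV"
    and s: "s \<notin> \<Gamma>" "2 * s \<in> \<Gamma>"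
  defines "W \<equiv> sv_carrier \<Gamma> s"
    and "cls \<equiv> coh_class (sv_carrier \<Gamma> s) sv_bracket"
    and "P \<equiv> \<Pi> k\<in>(UNIV :: int set). H2_line (sv_carrier \<Gamma> s) sv_bracket
               (coh_class (sv_carrier \<Gamma> s) sv_bracket (phi \<Gamma> s k))"
  shows "(\<forall>k. phi \<Gamma> s k \<in> cocycles2 W sv_bracket \<and> cls (phi \<Gamma> s k) \<noteq> coboundaries2 W sv_bracket) \<and>
    (\<exists>\<Theta>. bij_betw \<Theta> P (H2 W sv_bracket) \<and>
      (\<forall>u \<in> P. \<forall>v \<in> P. \<Theta> (\<lambda>k. H2_add (u k) (v k)) = H2_add (\<Theta> u) (\<Theta> v)) \<and>
      (\<forall>a. \<forall>u \<in> P. \<Theta> (\<lambda>k. H2_scale W sv_bracket a (u k)) = H2_scale W sv_bracket a (\<Theta> u)) \<and>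
      (\<forall>c. \<Theta> (\<lambda>k. H2_scale W sv_bracket (c k) (cls (phi \<Gamma> s k))) = cls (phi_sum \<Gamma> s c)))"
proof -
  interpret schroedinger_virasoro \<Gamma> s
    using zero add uminus s by unfold_locales
  have P: "P = range product_element"
    unfolding P_def by (rule product_eq_range)
  \<comment> \<open>Reads off the unique coefficient function of a product element and sends it to
    the class of the corresponding pointwise finite sum.\<close>
  define \<Theta> where "\<Theta> u = cls (phi_sum \<Gamma> s (inv product_element u))" for u
  have \<Theta>: "\<Theta> (product_element c) = cls (phi_sum \<Gamma> s c)" for c
    by (simp add: \<Theta>_def inv_f_f[OF inj_product_element])
  have "bij_betw \<Theta> P (H2 W sv_bracket)"
    unfolding bij_betw_def P W_def H2_eq_cls_phi_sum
    by (auto simp: inj_on_def \<Theta> cls_def cls_phi_sum_eq_iff image_image)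
  moreover have "\<Theta> (\<lambda>k. H2_add (u k) (v k)) = H2_add (\<Theta> u) (\<Theta> v)" if "u \<in> P" "v \<in> P" for u v
    using that by (auto simp: P product_element_add \<Theta> cls_def H2_add_cls_phi_sum)
  moreover have "\<Theta> (\<lambda>k. H2_scale W sv_bracket a (u k)) = H2_scale W sv_bracket a (\<Theta> u)" if "u \<in> P" for a u
    using that by (auto simp: P W_def product_element_scale \<Theta> cls_def H2_scale_cls_phi_sum)
  moreover have "\<Theta> (\<lambda>k. H2_scale W sv_bracket (c k) (cls (phi \<Gamma> s k))) = cls (phi_sum \<Gamma> s c)" for c
    using \<Theta>[of c] by (simp add: product_element_def[abs_def] W_def cls_def)
  moreover have "phi \<Gamma> s k \<in> cocycles2 W sv_bracket \<and> cls (phi \<Gamma> s k) \<noteq> coboundaries2 W sv_bracket" for k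
    using phi_sum_cocycle phi_not_coboundary unfolding W_def cls_def phi_eq_phi_sum by blast
  ultimately show ?thesis by blast
qed

end
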